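(* There exist an absolute constant $C>0$ and a randomized algorithm with the following property. For every $n\ge 1$ and every nonzero positive semidefinite matrix $\mathbf{A}\in\mathbb{R}^{n\times n}$, the algorithm, given entry-query access to $\mathbf{A}$, outputs a random index $I\in\{1,\dots,n\}$ such that $$\Pr[I=i]=\frac{\|\mathbf{A}_{*,i}\|_2^2}{\|\mathbf{A}\|_{\mathrm F}^2}\qquad\text{for all } i\in\{1,\dots,n\},$$ and the algorithm reads at most $Cn$ entries of $\mathbf{A}$ in expectation and performs at most $Cn$ arithmetic operations in expectation.
   Context: $\mathbf{A}_{*,i}$ is the $i$th column of $\mathbf{A}$ and $\|\cdot\|_{\mathrm F}$ is the Frobenius norm. A positive semidefinite (psd) matrix is a real symmetric matrix with $\mathbf{x}^\top\mathbf{A}\mathbf{x}\ge 0$ for all $\mathbf{x}\in\mathbb{R}^n$. Access model: the algorithm interacts with $\mathbf{A}$ only by (adaptively) querying individual entries $\mathbf{A}_{ij}$; it knows $n$. Cost is measured by the number of entry queries and by the number of arithmetic operations, where real arithmetic operations, comparisons, memory accesses and draws of a uniform random number in $[0,1]$ have unit cost. (In this model one can, after $O(n)$ preprocessing, draw independent samples from any explicitly given distribution on $\{1,\dots,n\}$ at $O(1)$ cost each.) *)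

theory Defs
  imports "HOL-Probability.Probability" "Jordan_Normal_Form.Matrix"
begin

section \<open>Matrices\<close>

definition psd :: "real mat \<Rightarrow> bool" where
  "psd A \<longleftrightarrow> square_mat A \<and> transpose_mat A = A \<and>
     (\<forall>x \<in> carrier_vec (dim_row A). 0 \<le> scalar_prod x (A *\<^sub>v x))"

definition vec_l2_norm :: "real vec \<Rightarrow> real" where
  "vec_l2_norm v = L2_set (\<lambda>i. vec_index v i) {..<dim_vec v}"

definition frobenius_norm :: "real mat \<Rightarrow> real" where
  "frobenius_norm A = sqrt (\<Sum>i<dim_row A. \<Sum>j<dim_col A. (A $$ (i, j))\<^sup>2)"


section \<open>A randomized real RAM with entry queries\<close>

text \<open>
  A program is one finite piece of syntax, so it is uniform in the dimension and can only depend
  on the matrix through the instruction \<open>Query\<close>. The machine has two sorts of data, indices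
  (natural numbers) and reals, each with registers and an indirectly addressed memory. There is no
  conversion between the sorts, in particular no rounding of reals to integers, and indices are
  only added and subtracted. Constants in programs are integers, so that no information can be
  hidden in them.

  \<open>DrawIndex x\<close> draws a uniform element of \<open>{0..<n}\<close>, where \<open>n\<close> is the dimension. It is the one
  primitive for sampling in constant time from a distribution on the indices; sampling from any
  other distribution has to be programmed.
\<close>

type_synonym ireg = nat
type_synonym rreg = nat

datatype instr =
    IConst ireg nat
  | IMove ireg ireg
  | IAdd ireg ireg ireg
  | ISub ireg ireg ireg   \<comment> \<open>truncated at 0\<close>
  | ILoad ireg ireg
  | IStore ireg ireg
  | RConst rreg int
  | RMove rreg rreg
  | RAdd rreg rreg rreg
  | RSub rreg rreg rreg
  | RMul rreg rreg rreg
  | RDiv rreg rreg rreg   \<comment> \<open>with value 0 for division by 0\<close>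
  | RLoad rreg ireg
  | RStore ireg rreg
  | Query rreg ireg ireg
  | Draw rreg
  | DrawIndex ireg

datatype test =
    ILess ireg ireg
  | ILeq ireg ireg
  | RLess rreg rreg
  | RLeq rreg rreg

datatype com =
    Skip
  | Do instr
  | Seq com com
  | If test com com
  | While test com

text \<open>
  The field \<open>pos\<close> is the number of random numbers consumed so far; \<open>ops\<close> counts all executed
  instructions (queries included) and all evaluated tests; \<open>queries\<close> counts the executed queries,
  with repetitions.
\<close>

record state =
  ireg :: "nat \<Rightarrow> nat"
  rreg :: "nat \<Rightarrow> real"
  imem :: "nat \<Rightarrow> nat"
  rmem :: "nat \<Rightarrow> real"
  pos :: nat
  ops :: nat
  queries :: nat

definition tick :: "state \<Rightarrow> state" where
  "tick s = s\<lparr>ops := Suc (ops s)\<rparr>"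

definition set_ireg :: "ireg \<Rightarrow> nat \<Rightarrow> state \<Rightarrow> state" where
  "set_ireg x k s = s\<lparr>ireg := (ireg s)(x := k)\<rparr>"

definition set_rreg :: "rreg \<Rightarrow> real \<Rightarrow> state \<Rightarrow> state" where
  "set_rreg x r s = s\<lparr>rreg := (rreg s)(x := r)\<rparr>"

text \<open>
  For a uniform \<open>u\<close> in \<open>[0,1]\<close> and \<open>n \<ge> 1\<close>, the value \<open>unit_to_index n u\<close> is uniform on
  \<open>{0..<n}\<close>; the minimum only matters for the null event \<open>u = 1\<close>.
\<close>

definition unit_to_index :: "nat \<Rightarrow> real \<Rightarrow> nat" where
  "unit_to_index n u = min (nat \<lfloor>real n * u\<rfloor>) (n - 1)"

text \<open>
  In the following, \<open>n\<close> is the dimension, \<open>a\<close> the matrix seen as a table of entries and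
  \<open>\<omega>\<close> the sequence of random numbers that the run draws from.
\<close>

fun effect :: "nat \<Rightarrow> (nat \<Rightarrow> nat \<Rightarrow> real) \<Rightarrow> (nat \<Rightarrow> real) \<Rightarrow> instr \<Rightarrow> state \<Rightarrow> state" where
  "effect n a \<omega> (IConst x k) s = set_ireg x k s"
| "effect n a \<omega> (IMove x y) s = set_ireg x (ireg s y) s"
| "effect n a \<omega> (IAdd x y z) s = set_ireg x (ireg s y + ireg s z) s"
| "effect n a \<omega> (ISub x y z) s = set_ireg x (ireg s y - ireg s z) s"
| "effect n a \<omega> (ILoad x y) s = set_ireg x (imem s (ireg s y)) s"
| "effect n a \<omega> (IStore x y) s = s\<lparr>imem := (imem s)(ireg s x := ireg s y)\<rparr>"
| "effect n a \<omega> (RConst x c) s = set_rreg x (of_int c) s"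
| "effect n a \<omega> (RMove x y) s = set_rreg x (rreg s y) s"
| "effect n a \<omega> (RAdd x y z) s = set_rreg x (rreg s y + rreg s z) s"
| "effect n a \<omega> (RSub x y z) s = set_rreg x (rreg s y - rreg s z) s"
| "effect n a \<omega> (RMul x y z) s = set_rreg x (rreg s y * rreg s z) s"
| "effect n a \<omega> (RDiv x y z) s = set_rreg x (rreg s y / rreg s z) s"
| "effect n a \<omega> (RLoad x y) s = set_rreg x (rmem s (ireg s y)) s"
| "effect n a \<omega> (RStore x y) s = s\<lparr>rmem := (rmem s)(ireg s x := rreg s y)\<rparr>"
| "effect n a \<omega> (Query x y z) s =
     (set_rreg x (a (ireg s y) (ireg s z)) s)\<lparr>queries := Suc (queries s)\<rparr>"
| "effect n a \<omega> (Draw x) s = (set_rreg x (\<omega> (pos s)) s)\<lparr>pos := Suc (pos s)\<rparr>"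
| "effect n a \<omega> (DrawIndex x) s =
     (set_ireg x (unit_to_index n (\<omega> (pos s))) s)\<lparr>pos := Suc (pos s)\<rparr>"

fun holds :: "test \<Rightarrow> state \<Rightarrow> bool" where
  "holds (ILess x y) s \<longleftrightarrow> ireg s x < ireg s y"
| "holds (ILeq x y) s \<longleftrightarrow> ireg s x \<le> ireg s y"
| "holds (RLess x y) s \<longleftrightarrow> rreg s x < rreg s y"
| "holds (RLeq x y) s \<longleftrightarrow> rreg s x \<le> rreg s y"

inductive exec :: "nat \<Rightarrow> (nat \<Rightarrow> nat \<Rightarrow> real) \<Rightarrow> (nat \<Rightarrow> real) \<Rightarrow> com \<Rightarrow> state \<Rightarrow> state \<Rightarrow> bool"
  for n a \<omega> where
  Skip: "exec n a \<omega> Skip s s"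
| Do: "exec n a \<omega> (Do c) s (tick (effect n a \<omega> c s))"
| Seq: "exec n a \<omega> p s t \<Longrightarrow> exec n a \<omega> q t u \<Longrightarrow> exec n a \<omega> (Seq p q) s u"
| IfTrue: "holds b s \<Longrightarrow> exec n a \<omega> p (tick s) t \<Longrightarrow> exec n a \<omega> (If b p q) s t"
| IfFalse: "\<not> holds b s \<Longrightarrow> exec n a \<omega> q (tick s) t \<Longrightarrow> exec n a \<omega> (If b p q) s t"
| WhileTrue: "holds b s \<Longrightarrow> exec n a \<omega> p (tick s) t \<Longrightarrow> exec n a \<omega> (While b p) t u \<Longrightarrow>
    exec n a \<omega> (While b p) s u"
| WhileFalse: "\<not> holds b s \<Longrightarrow> exec n a \<omega> (While b p) s (tick s)"

inductive_cases Skip_E: "exec n a \<omega> Skip s t"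
inductive_cases Do_E: "exec n a \<omega> (Do c) s t"
inductive_cases Seq_E: "exec n a \<omega> (Seq p q) s t"
inductive_cases If_E: "exec n a \<omega> (If b p q) s t"
inductive_cases While_E: "exec n a \<omega> (While b p) s t"

lemma exec_deterministic:
  "exec n a \<omega> p s t \<Longrightarrow> exec n a \<omega> p s t' \<Longrightarrow> t' = t"
proof (induction arbitrary: t' rule: exec.induct)
  case (Skip s)
  then show ?case by (blast elim: Skip_E)
next
  case (Do c s)
  then show ?case by (blast elim: Do_E)
next
  case (Seq p s t q u)
  then show ?case by (blast elim: Seq_E)
next
  case (IfTrue b s p t q)
  then show ?case by (blast elim: If_E)
next
  case (IfFalse b s q t p)
  then show ?case by (blast elim: If_E)
next
  case (WhileTrue b s p t u)
  then show ?case by (blast elim: While_E)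
next
  case (WhileFalse b s p)
  then show ?case by (blast elim: While_E)
qed


section \<open>Runs on a matrix\<close>

text \<open>The input, in index register 0, is the dimension.\<close>

definition initial :: "nat \<Rightarrow> state" where
  "initial n = \<lparr>ireg = (\<lambda>_. 0)(0 := n), rreg = (\<lambda>_. 0), imem = (\<lambda>_. 0), rmem = (\<lambda>_. 0),
     pos = 0, ops = 0, queries = 0\<rparr>"

definition entry :: "real mat \<Rightarrow> nat \<Rightarrow> nat \<Rightarrow> real" where
  "entry A i j = (if i < dim_row A \<and> j < dim_col A then A $$ (i, j) else 0)"

text \<open>The final state, or \<open>None\<close> if the run does not terminate.\<close>

definition result :: "com \<Rightarrow> real mat \<Rightarrow> (nat \<Rightarrow> real) \<Rightarrow> state option" where
  "result P A \<omega> =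
     (let n = dim_row A in
      if \<exists>t. exec n (entry A) \<omega> P (initial n) t
      then Some (THE t. exec n (entry A) \<omega> P (initial n) t) else None)"

lemma result_eq_SomeI:
  "exec (dim_row A) (entry A) \<omega> P (initial (dim_row A)) t \<Longrightarrow> result P A \<omega> = Some t"
  unfolding result_def Let_def by (auto dest: exec_deterministic intro!: the_equality)

definition output_index :: "com \<Rightarrow> real mat \<Rightarrow> (nat \<Rightarrow> real) \<Rightarrow> nat option" where
  "output_index P A \<omega> = map_option (\<lambda>t. ireg t 0) (result P A \<omega>)"

definition query_count :: "com \<Rightarrow> real mat \<Rightarrow> (nat \<Rightarrow> real) \<Rightarrow> ennreal" where
  "query_count P A \<omega> = (case result P A \<omega> of None \<Rightarrow> \<infinity> | Some t \<Rightarrow> of_nat (queries t))"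

definition op_count :: "com \<Rightarrow> real mat \<Rightarrow> (nat \<Rightarrow> real) \<Rightarrow> ennreal" where
  "op_count P A \<omega> = (case result P A \<omega> of None \<Rightarrow> \<infinity> | Some t \<Rightarrow> of_nat (ops t))"

text \<open>Independent uniform random numbers in \<open>[0,1]\<close>.\<close>

definition coins :: "(nat \<Rightarrow> real) measure" where
  "coins = Pi\<^sub>M UNIV (\<lambda>_. uniform_measure lborel {0..1})"

end

theory Submission
  imports Defs
begin

text \<open>
  Rejection sampling: draw independent indices \<open>i\<close>, \<open>j\<close> with probabilities proportional to the
  diagonal and output \<open>i\<close> with probability \<open>A_ji^2 / (A_ii A_jj)\<close>, which is at most 1 because the
  2 by 2 principal minors of a psd matrix are nonnegative. A round outputs \<open>i\<close> with probability
  \<open>|A_*i|^2 / tr(A)^2\<close>, hence succeeds with probability \<open>|A|_F^2 / tr(A)^2 \<ge> 1/n\<close> by Cauchy-Schwarz.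

  To draw from the diagonal in constant time, cut each \<open>A_ii\<close> into slots of mass \<open>tr(A)/n\<close> and one
  slot of smaller mass; at most \<open>2n\<close> slots arise. Drawing a uniform slot and accepting it with
  probability proportional to its mass costs another factor 4 in the expected number of rounds when
  this is merged into the acceptance test of the round.
\<close>

section \<open>Executions of programs\<close>

fun loop_free :: "com \<Rightarrow> bool" where
  "loop_free Skip \<longleftrightarrow> True"
| "loop_free (Do c) \<longleftrightarrow> True"
| "loop_free (Seq p q) \<longleftrightarrow> loop_free p \<and> loop_free q"
| "loop_free (If b p q) \<longleftrightarrow> loop_free p \<and> loop_free q"
| "loop_free (While b p) \<longleftrightarrow> False"

text \<open>The \<open>While\<close> clause is a dummy; \<open>run\<close> describes executions only
  under \<open>loop_free\<close>.\<close>

fun run :: "nat \<Rightarrow> (nat \<Rightarrow> nat \<Rightarrow> real) \<Rightarrow> (nat \<Rightarrow> real) \<Rightarrow> com \<Rightarrow> state \<Rightarrow> state" where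
  "run n a \<omega> Skip s = s"
| "run n a \<omega> (Do c) s = tick (effect n a \<omega> c s)"
| "run n a \<omega> (Seq p q) s = run n a \<omega> q (run n a \<omega> p s)"
| "run n a \<omega> (If b p q) s = (if holds b s then run n a \<omega> p (tick s) else run n a \<omega> q (tick s))"
| "run n a \<omega> (While b p) s = s"

lemma exec_run: "loop_free p \<Longrightarrow> exec n a \<omega> p s (run n a \<omega> p s)"
  by (induction p arbitrary: s) (auto intro: exec.intros)

lemma exec_loop_free_iff: "loop_free p \<Longrightarrow> exec n a \<omega> p s t \<longleftrightarrow> t = run n a \<omega> p s"
  using exec_run exec_deterministic by blast

lemma exec_Seq_iff: "exec n a \<omega> (Seq p q) s u \<longleftrightarrow> (\<exists>t. exec n a \<omega> p s t \<and> exec n a \<omega> q t u)"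
  by (blast elim: Seq_E intro: exec.Seq)

lemma exec_While_unfold:
  assumes "loop_free p"
  shows "exec n a \<omega> (While b p) s t \<longleftrightarrow>
    (if holds b s then exec n a \<omega> (While b p) (run n a \<omega> p (tick s)) t else t = tick s)"
  using assms exec_loop_free_iff[OF assms]
  by (auto elim: While_E intro: exec.WhileTrue exec.WhileFalse)

text \<open>A loop-free body is a total function on states, so the loop just iterates
  \<open>f\<close>, which also pays for the test. The equivalence serves both directions: runs are
  built from it, and divergence follows when no iterate falsifies the test.\<close>

lemma exec_While_iff:
  fixes n a \<omega> p
  assumes p: "loop_free p"
  defines "f \<equiv> \<lambda>s. run n a \<omega> p (tick s)"
  shows "exec n a \<omega> (While b p) s t \<longleftrightarrow>
    (\<exists>m. (\<forall>k<m. holds b ((f ^^ k) s)) \<and> \<not> holds b ((f ^^ m) s) \<and> t = tick ((f ^^ m) s))"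
proof
  assume "exec n a \<omega> (While b p) s t"
  then show "\<exists>m. (\<forall>k<m. holds b ((f ^^ k) s)) \<and> \<not> holds b ((f ^^ m) s) \<and> t = tick ((f ^^ m) s)"
  proof (induction "While b p" s t rule: exec.induct)
    case (WhileTrue s t u)
    then obtain m where m: "\<forall>k<m. holds b ((f ^^ k) t)" "\<not> holds b ((f ^^ m) t)"
      "u = tick ((f ^^ m) t)" by blast
    have t: "t = f s"
      using WhileTrue.hyps(2) exec_loop_free_iff[OF p] by (simp add: f_def)
    have "\<forall>k<Suc m. holds b ((f ^^ k) s)"
      using m(1) WhileTrue.hyps(1) by (simp add: t less_Suc_eq_0_disj funpow_Suc_right del: funpow.simps) 
        (auto simp: funpow_swap1)
    moreover have "(f ^^ Suc m) s = (f ^^ m) t"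
      by (simp add: t funpow_swap1)
    ultimately show ?case using m(2,3) by metis
  next
    case (WhileFalse s)
    then show ?case by (intro exI[of _ 0]) auto
  qed
next
  assume "\<exists>m. (\<forall>k<m. holds b ((f ^^ k) s)) \<and> \<not> holds b ((f ^^ m) s) \<and> t = tick ((f ^^ m) s)"
  then obtain m where "\<forall>k<m. holds b ((f ^^ k) s)" "\<not> holds b ((f ^^ m) s)"
    "t = tick ((f ^^ m) s)" by blast
  then show "exec n a \<omega> (While b p) s t"
  proof (induction m arbitrary: s)
    case 0
    then show ?case by (auto intro: exec.WhileFalse)
  next
    case (Suc m)
    have "holds b s" using Suc.prems(1) by (metis funpow_0 zero_less_Suc)
    moreover have "exec n a \<omega> (While b p) (f s) t"
    proof (rule Suc.IH)
      show "\<forall>k<m. holds b ((f ^^ k) (f s))"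
        using Suc.prems(1) by (metis Suc_mono comp_apply funpow_Suc_right)
    qed (use Suc.prems in \<open>simp_all add: funpow_swap1\<close>)
    ultimately show ?case
      using exec_While_unfold[OF p] by (simp add: f_def)
  qed
qed

text \<open>Meant for counting loops: the invariant is indexed by the iteration number and
  \<open>m\<close> is known beforehand. The last \<open>tick\<close> pays for the failing
  test.\<close>

lemma exec_While_count:
  assumes p: "loop_free p" and init: "I 0 s"
    and step: "\<And>k s. k < m \<Longrightarrow> I k s \<Longrightarrow> holds b s \<and> I (Suc k) (run n a \<omega> p (tick s))"
    and stop: "\<And>s. I m s \<Longrightarrow> \<not> holds b s"
  shows "\<exists>t. I m t \<and> exec n a \<omega> (While b p) s (tick t)"
proof -
  let ?f = "\<lambda>s. run n a \<omega> p (tick s)"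
  have inv: "I k ((?f ^^ k) s)" if "k \<le> m" for k
    using that by (induction k) (use init step in auto)
  then have "\<forall>k<m. holds b ((?f ^^ k) s)" "\<not> holds b ((?f ^^ m) s)"
    using step stop by (meson less_imp_le order_refl)+
  then show ?thesis
    unfolding exec_While_iff[OF p] using inv[of m] by blast
qed

section \<open>Programs that consume no randomness\<close>

fun draw_free_instr :: "instr \<Rightarrow> bool" where
  "draw_free_instr (Draw x) = False"
| "draw_free_instr (DrawIndex x) = False"
| "draw_free_instr _ = True"

fun draw_free :: "com \<Rightarrow> bool" where
  "draw_free Skip \<longleftrightarrow> True"
| "draw_free (Do c) \<longleftrightarrow> draw_free_instr c"
| "draw_free (Seq p q) \<longleftrightarrow> draw_free p \<and> draw_free q"
| "draw_free (If b p q) \<longleftrightarrow> draw_free p \<and> draw_free q"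
| "draw_free (While b p) \<longleftrightarrow> draw_free p"

lemma effect_draw_free: "draw_free_instr c \<Longrightarrow> effect n a \<omega> c s = effect n a \<omega>' c s"
  by (cases c) auto

text \<open>Only the two drawing instructions look at the random sequence. Hence the preparation
  ends in one and the same state for all sequences, and the slot table is not random.\<close>

lemma exec_draw_free:
  "exec n a \<omega> p s t \<Longrightarrow> draw_free p \<Longrightarrow> exec n a \<omega>' p s t"
proof (induction rule: exec.induct)
  case (Do c s)
  then show ?case
    using exec.Do[of n a \<omega>' c s] effect_draw_free[of c n a \<omega> s \<omega>'] by simp
qed (auto intro: exec.intros)

fun instrs :: "instr list \<Rightarrow> com" where
  "instrs [] = Skip"
| "instrs (c # cs) = Seq (Do c) (instrs cs)"

lemma loop_free_instrs [simp]: "loop_free (instrs cs)"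
  by (induction cs) auto

lemma draw_free_instrs [simp]: "draw_free (instrs cs) \<longleftrightarrow> list_all draw_free_instr cs"
  by (induction cs) auto

section \<open>Uniform random numbers\<close>

text \<open>The machine draws uniform indices below \<open>n\<close> only; a fair coin picks the
  lower or the upper half of the \<open>2 * n\<close> slots.\<close>

definition slot :: "nat \<Rightarrow> real \<Rightarrow> real \<Rightarrow> nat" where
  "slot n u v = unit_to_index n u + (if v < 1 / 2 then n else 0)"

lemma measurable_unit_to_index [measurable]: "unit_to_index n \<in> borel \<rightarrow>\<^sub>M count_space UNIV"
  unfolding unit_to_index_def by measurable

lemma measurable_slot [measurable]:
  assumes [measurable]: "f \<in> M \<rightarrow>\<^sub>M borel" "g \<in> M \<rightarrow>\<^sub>M borel"
  shows "(\<lambda>x. slot n (f x) (g x)) \<in> M \<rightarrow>\<^sub>M count_space UNIV"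
proof -
  have "(\<lambda>x. unit_to_index n (f x) + c) \<in> M \<rightarrow>\<^sub>M count_space UNIV" for c
    using measurable_compose[OF assms(1) measurable_unit_to_index, of n]
    by (rule measurable_compose) simp
  moreover have "{x \<in> space M. g x < 1 / 2} \<in> sets M"
    using assms(2) by simp
  ultimately have "(\<lambda>x. if g x < 1 / 2 then unit_to_index n (f x) + n else unit_to_index n (f x) + 0)
      \<in> M \<rightarrow>\<^sub>M count_space UNIV"
    by (intro measurable_If)
  then show ?thesis by (simp add: slot_def if_distrib)
qed

section \<open>The coin sequence as a product of uniform measures\<close>

definition unif :: "real measure" where
  "unif = uniform_measure lborel {0..1}"

lemma sets_unif [simp, measurable_cong]: "sets unif = sets borel"
  by (simp add: unif_def)

lemma space_unif [simp]: "space unif = UNIV"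
  by (simp add: unif_def)

interpretation unif: prob_space unif
  unfolding unif_def by (rule prob_space_uniform_measure) auto

interpretation unif_seq: sequence_space unif
  by unfold_locales

lemma coins_eq: "coins = Pi\<^sub>M UNIV (\<lambda>_. unif)"
  by (simp add: coins_def unif_def)

lemma space_coins [simp]: "space coins = UNIV"
  by (simp add: coins_eq space_PiM)

interpretation coins: prob_space coins
  unfolding coins_eq by (rule unif_seq.prob_space_axioms)

lemma emeasure_coins_UNIV [simp]: "emeasure coins UNIV = 1"
  using coins.emeasure_space_1 by simp

lemma sets_coins_Collect [measurable (raw)]:
  "Measurable.pred coins P \<Longrightarrow> {\<omega>. P \<omega>} \<in> sets coins"
  by (simp add: pred_def)

lemma measurable_coins_component: "(\<lambda>\<omega>. \<omega> i) \<in> coins \<rightarrow>\<^sub>M borel"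
proof -
  have "(\<lambda>\<omega>. \<omega> i) \<in> coins \<rightarrow>\<^sub>M unif"
    unfolding coins_eq by (rule measurable_component_singleton) simp
  then show ?thesis by (simp cong: measurable_cong_sets)
qed

lemma measurable_coins_shift: "(\<lambda>\<omega> k. \<omega> (i + k)) \<in> coins \<rightarrow>\<^sub>M coins"
  unfolding coins_eq by (rule measurable_PiM_single') (auto simp: space_PiM)

text \<open>\<open>comb_seq b \<omega> \<omega>'\<close> starts with the first \<open>b\<close>
  terms of \<open>\<omega>\<close> and continues with \<open>\<omega>'\<close>. Splicing two
  independent coin sequences yields a coin sequence again; this is how independence of the first
  \<open>b\<close> coins from the rest is used.\<close>

lemma nn_integral_coins_comb_seq:
  assumes [measurable]: "F \<in> borel_measurable coins"
  shows "(\<integral>\<^sup>+\<omega>. F \<omega> \<partial>coins) = (\<integral>\<^sup>+\<omega>. (\<integral>\<^sup>+\<omega>'. F (comb_seq b \<omega> \<omega>') \<partial>coins) \<partial>coins)"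
proof -
  have [measurable]: "(\<lambda>(\<omega>, \<omega>'). comb_seq b \<omega> \<omega>') \<in> coins \<Otimes>\<^sub>M coins \<rightarrow>\<^sub>M coins"
    unfolding coins_eq by (rule measurable_comb_seq)
  have "(\<integral>\<^sup>+\<omega>. F \<omega> \<partial>coins) =
      (\<integral>\<^sup>+\<omega>. F \<omega> \<partial>distr (coins \<Otimes>\<^sub>M coins) coins (\<lambda>(\<omega>, \<omega>'). comb_seq b \<omega> \<omega>'))"
    using unif_seq.PiM_comb_seq[of b] by (simp add: coins_eq)
  also have "\<dots> = (\<integral>\<^sup>+x. F (case x of (\<omega>, \<omega>') \<Rightarrow> comb_seq b \<omega> \<omega>') \<partial>(coins \<Otimes>\<^sub>M coins))"
    by (rule nn_integral_distr) measurable
  also have "\<dots> = (\<integral>\<^sup>+\<omega>. (\<integral>\<^sup>+\<omega>'. F (comb_seq b \<omega> \<omega>') \<partial>coins) \<partial>coins)"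
    by (subst coins.nn_integral_fst[symmetric]) (auto simp: split_beta')
  finally show ?thesis .
qed

lemma nn_integral_coins_case_nat:
  assumes [measurable]: "F \<in> borel_measurable coins"
  shows "(\<integral>\<^sup>+\<omega>. F \<omega> \<partial>coins) = (\<integral>\<^sup>+u. (\<integral>\<^sup>+\<omega>. F (case_nat u \<omega>) \<partial>coins) \<partial>unif)"
proof -
  have [measurable]: "(\<lambda>(u, \<omega>). case_nat u \<omega>) \<in> unif \<Otimes>\<^sub>M coins \<rightarrow>\<^sub>M coins"
    unfolding coins_eq by measurable
  have "(\<integral>\<^sup>+\<omega>. F \<omega> \<partial>coins) =
      (\<integral>\<^sup>+\<omega>. F \<omega> \<partial>distr (unif \<Otimes>\<^sub>M coins) coins (\<lambda>(u, \<omega>). case_nat u \<omega>))"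
    using unif_seq.PiM_iter by (simp add: coins_eq)
  also have "\<dots> = (\<integral>\<^sup>+x. F (case x of (u, \<omega>) \<Rightarrow> case_nat u \<omega>) \<partial>(unif \<Otimes>\<^sub>M coins))"
    by (rule nn_integral_distr) measurable
  also have "\<dots> = (\<integral>\<^sup>+u. (\<integral>\<^sup>+\<omega>. F (case_nat u \<omega>) \<partial>coins) \<partial>unif)"
    by (subst coins.nn_integral_fst[symmetric]) (auto simp: split_beta')
  finally show ?thesis .
qed

section \<open>Uniform indices and uniform slots\<close>

lemma unit_to_index_less: "1 \<le> n \<Longrightarrow> unit_to_index n u < n"
  by (auto simp: unit_to_index_def min_def)

lemma emeasure_unif: "A \<in> sets borel \<Longrightarrow> emeasure unif A = emeasure lborel ({0..1} \<inter> A)"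
  by (simp add: unif_def divide_ennreal_def)

text \<open>Within the unit interval the preimage of \<open>k\<close> lies between the open and the
  closed interval from \<open>k / n\<close> to \<open>(k + 1) / n\<close>, both of length
  \<open>1 / n\<close>. The closed one accounts for \<open>u = 1\<close>, where the minimum yields
  \<open>n - 1\<close>.\<close>

lemma emeasure_unif_unit_to_index:
  assumes "k < n"
  shows "emeasure unif {u. unit_to_index n u = k} = ennreal (1 / n)"
proof -
  let ?S = "{0..1} \<inter> {u. unit_to_index n u = k}"
  have n: "0 < real n" using assms by simp
  have [measurable]: "?S \<in> sets borel" by measurable
  have *: "real (unit_to_index n u) \<le> n * u \<and> n * u \<le> real (unit_to_index n u) + 1"
    if "0 \<le> u" "u \<le> 1" for u :: real
  proof -
    have nu: "0 \<le> n * u" "n * u \<le> n"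
      using that n by (auto simp: mult_left_le)
    have "nat \<lfloor>n * u\<rfloor> \<le> n"
      using nu by linarith
    have fl: "real (nat \<lfloor>n * u\<rfloor>) \<le> n * u" "n * u < real (nat \<lfloor>n * u\<rfloor>) + 1"
      using nu by linarith+
    show ?thesis
      using nu fl assms unfolding unit_to_index_def by (auto simp: min_def of_nat_diff)
  qed
  have sub: "?S \<subseteq> {real k / n .. (real k + 1) / n}"
  proof
    fix u assume u: "u \<in> ?S"
    then show "u \<in> {real k / n .. (real k + 1) / n}"
      using *[of u] n by (auto simp: field_simps)
  qed
  have sup: "{real k / n <..< (real k + 1) / n} \<subseteq> ?S"
  proof
    fix u assume u: "u \<in> {real k / n <..< (real k + 1) / n}"
    then have u': "real k < n * u" "n * u < real k + 1" using n by (auto simp: field_simps)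
    have "0 < n * u" using u' by linarith
    then have "0 \<le> u" using n by (simp add: zero_less_mult_iff)
    moreover have "n * u \<le> n * 1" using u' assms by linarith
    then have "u \<le> 1" using n by (simp add: mult_le_cancel_left)
    moreover have "\<lfloor>n * u\<rfloor> = int k" using u' by linarith
    then have "unit_to_index n u = k" using assms by (simp add: unit_to_index_def)
    ultimately show "u \<in> ?S" by simp
  qed
  have len: "(real k + 1) / n - real k / n = 1 / n" by (simp add: diff_divide_distrib[symmetric])
  have le: "real k / n \<le> (real k + 1) / n" using n by (simp add: divide_right_mono)
  have "emeasure lborel ?S \<le> emeasure lborel {real k / n .. (real k + 1) / n}"
    by (rule emeasure_mono[OF sub]) simp
  moreover have "emeasure lborel {real k / n <..< (real k + 1) / n} \<le> emeasure lborel ?S"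
    by (rule emeasure_mono[OF sup]) simp
  ultimately have "emeasure lborel ?S = ennreal (1 / n)"
    using le by (simp add: len)
  then show ?thesis by (subst emeasure_unif) simp_all
qed

lemma nn_integral_unit_to_index:
  assumes "1 \<le> n"
  shows "(\<integral>\<^sup>+u. F (unit_to_index n u) \<partial>unif) = (\<Sum>k<n. F k) * ennreal (1 / n)"
proof -
  have meas: "{u. unit_to_index n u = k} \<in> sets borel" for k
    using measurable_sets[OF measurable_unit_to_index, of "{k}" n] by (simp add: vimage_def)
  have "(\<integral>\<^sup>+u. F (unit_to_index n u) \<partial>unif) =
      (\<integral>\<^sup>+u. (\<Sum>k<n. F k * indicator {u. unit_to_index n u = k} u) \<partial>unif)"
    using unit_to_index_less[OF assms]
    by (intro nn_integral_cong) (simp add: indicator_def sum.delta if_distrib cong: if_cong)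
  also have "\<dots> = (\<Sum>k<n. \<integral>\<^sup>+u. F k * indicator {u. unit_to_index n u = k} u \<partial>unif)"
    by (intro nn_integral_sum borel_measurable_times_ennreal borel_measurable_const
      borel_measurable_indicator) (use meas in simp)
  also have "\<dots> = (\<Sum>k<n. F k * emeasure unif {u. unit_to_index n u = k})"
    by (intro sum.cong refl nn_integral_cmult_indicator) (use meas in simp)
  also have "\<dots> = (\<Sum>k<n. F k * ennreal (1 / n))"
    by (intro sum.cong) (auto simp: emeasure_unif_unit_to_index)
  finally show ?thesis by (simp add: sum_distrib_right)
qed

lemma emeasure_unif_less:
  assumes "0 \<le> c" "c \<le> 1"
  shows "emeasure unif {u. u < c} = ennreal c"
proof -
  have "{0..1} \<inter> {u. u < c} = {0..<c}" using assms by auto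
  then show ?thesis using assms by (subst emeasure_unif) simp_all
qed

lemma nn_integral_unif_less:
  fixes F :: "bool \<Rightarrow> ennreal"
  shows "(\<integral>\<^sup>+u. F (u < 1 / 2) \<partial>unif) = (F True + F False) * ennreal (1 / 2)"
proof -
  have f: "emeasure unif {u. \<not> u < 1 / 2} = ennreal (1 / 2)"
  proof -
    have "{0..1} \<inter> {u. \<not> u < 1 / 2} = {1/2..1::real}" by auto
    then show ?thesis by (subst emeasure_unif) simp_all
  qed
  have "(\<integral>\<^sup>+u. F (u < 1 / 2) \<partial>unif) = (\<integral>\<^sup>+u. F True * indicator {u. u < 1 / 2} u +
      F False * indicator {u. \<not> u < 1 / 2} u \<partial>unif)"
    by (intro nn_integral_cong) (auto split: split_indicator)
  also have "\<dots> = F True * ennreal (1 / 2) + F False * ennreal (1 / 2)"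
  proof -
    have m: "{u::real. u < 1 / 2} \<in> sets unif" "{u::real. \<not> u < 1 / 2} \<in> sets unif"
      by simp_all
    have "(\<integral>\<^sup>+u. F True * indicator {u. u < 1 / 2} u +
        F False * indicator {u. \<not> u < 1 / 2} u \<partial>unif) =
      (\<integral>\<^sup>+u. F True * indicator {u. u < 1 / 2} u \<partial>unif) +
      (\<integral>\<^sup>+u. F False * indicator {u. \<not> u < 1 / 2} u \<partial>unif)"
      by (intro nn_integral_add borel_measurable_times_ennreal borel_measurable_const
        borel_measurable_indicator m)
    then show ?thesis
      using emeasure_unif_less[of "1/2"] f by (simp add: nn_integral_cmult_indicator m)
  qed
  finally show ?thesis by (simp add: distrib_right)
qed

lemma nn_integral_slot:
  assumes n: "1 \<le> n"
  shows "(\<integral>\<^sup>+u. (\<integral>\<^sup>+v. F (slot n u v) \<partial>unif) \<partial>unif) = (\<Sum>s<2 * n. F s) * ennreal (1 / (2 * real n))"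
proof -
  have "(\<integral>\<^sup>+u. (\<integral>\<^sup>+v. F (slot n u v) \<partial>unif) \<partial>unif) =
      (\<integral>\<^sup>+u. (F (unit_to_index n u + n) + F (unit_to_index n u)) * ennreal (1 / 2) \<partial>unif)"
    unfolding slot_def
    using nn_integral_unif_less[of "\<lambda>c. F (unit_to_index n u + (if c then n else 0))" for u] by simp
  also have "\<dots> = (\<Sum>k<n. (F (k + n) + F k) * ennreal (1 / 2)) * ennreal (1 / n)"
    using n by (rule nn_integral_unit_to_index)
  also have "\<dots> = (\<Sum>k<n. F (k + n) + F k) * (ennreal (1 / 2) * ennreal (1 / n))"
    by (simp add: sum_distrib_right mult.assoc)
  also have "ennreal (1 / 2) * ennreal (1 / n) = ennreal (1 / (2 * real n))"
    by (subst ennreal_mult[symmetric]) simp_all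
  also have "(\<Sum>k<n. F (k + n) + F k) = (\<Sum>s<2 * n. F s)"
  proof -
    have "(\<Sum>s<2 * n. F s) = (\<Sum>s<n. F s) + (\<Sum>s\<in>{n..<2*n}. F s)"
      by (subst sum.union_disjoint[symmetric]) (auto intro!: sum.cong)
    also have "(\<Sum>s\<in>{n..<2*n}. F s) = (\<Sum>k<n. F (k + n))"
      using sum.shift_bounds_nat_ivl[of F 0 n n] by (simp add: mult_2 atLeast0LessThan)
    finally show ?thesis by (simp add: sum.distrib add.commute)
  qed
  finally show ?thesis .
qed

section \<open>Integrals over the coins of one round\<close>

lemma nn_integral_coins_head:
  assumes [measurable]: "F \<in> borel_measurable borel"
  shows "(\<integral>\<^sup>+\<omega>. F (\<omega> 0) \<partial>coins) = (\<integral>\<^sup>+u. F u \<partial>unif)"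
  by (subst nn_integral_coins_case_nat)
    (simp_all add: measurable_compose[OF measurable_coins_component])

lemma nn_integral_coins_slot:
  fixes F :: "nat \<Rightarrow> ennreal"
  assumes n: "1 \<le> n"
  shows "(\<integral>\<^sup>+\<omega>. F (slot n (\<omega> 0) (\<omega> 1)) \<partial>coins) = (\<Sum>s<2 * n. F s) * ennreal (1 / (2 * real n))"
proof -
  have "(\<integral>\<^sup>+\<omega>. F (slot n (\<omega> 0) (\<omega> 1)) \<partial>coins) =
      (\<integral>\<^sup>+u. (\<integral>\<^sup>+\<omega>. F (slot n u (\<omega> 0)) \<partial>coins) \<partial>unif)"
    by (subst nn_integral_coins_case_nat)
      (simp_all add: measurable_compose[OF measurable_slot[OF measurable_coins_component measurable_coins_component]])
  also have "\<dots> = (\<integral>\<^sup>+u. (\<integral>\<^sup>+v. F (slot n u v) \<partial>unif) \<partial>unif)"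
    by (intro nn_integral_cong nn_integral_coins_head) (simp add: measurable_compose[OF measurable_slot])
  finally show ?thesis using n by (simp add: nn_integral_slot)
qed

text \<open>The five coins are split into 2 + 2 + 1 and integrated from the inside out: the last
  coin gives \<open>T s t\<close>, and each pair averages over \<open>2 * n\<close> slots. The
  predicate \<open>Q\<close> on the first slot covers both plain success and the output of a fixed
  index.\<close>

lemma emeasure_slots_accept:
  assumes n: "1 \<le> n" and T: "\<And>s t. 0 \<le> T s t" "\<And>s t. T s t \<le> 1"
  shows "emeasure coins {\<omega>. Q (slot n (\<omega> 0) (\<omega> 1)) \<and>
      \<omega> 4 < T (slot n (\<omega> 0) (\<omega> 1)) (slot n (\<omega> 2) (\<omega> 3))} =
    ennreal ((\<Sum>s<2 * n. \<Sum>t<2 * n. if Q s then T s t else 0) / (4 * (real n)\<^sup>2))"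
proof -
  define E where "E s t = {u. Q s \<and> u < T s t}" for s t
  define h where "h s t = (if Q s then T s t else 0)" for s t
  have h: "0 \<le> h s t" for s t by (simp add: h_def T)
  have [measurable]: "E s t \<in> sets borel" for s t
    by (cases "Q s") (simp_all add: E_def lessThan_def[symmetric])
  have E: "emeasure unif (E s t) = ennreal (h s t)" for s t
    using emeasure_unif_less[OF T] by (simp add: E_def h_def)
  have ind: "(\<lambda>\<omega>. indicator (E (\<sigma> \<omega>) (\<tau> \<omega>)) (f \<omega>) :: ennreal) \<in> borel_measurable coins"
    if [measurable]: "\<sigma> \<in> coins \<rightarrow>\<^sub>M count_space UNIV" "\<tau> \<in> coins \<rightarrow>\<^sub>M count_space UNIV"
      "f \<in> borel_measurable coins" for \<sigma> \<tau> f
  proof -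
    have "Measurable.pred coins (\<lambda>\<omega>. f \<omega> \<in> E (\<sigma> \<omega>) (\<tau> \<omega>))"
      unfolding E_def mem_Collect_eq by measurable
    then have "{\<omega>. f \<omega> \<in> E (\<sigma> \<omega>) (\<tau> \<omega>)} \<in> sets coins" by (rule sets_coins_Collect)
    then have "indicator {\<omega>. f \<omega> \<in> E (\<sigma> \<omega>) (\<tau> \<omega>)} \<in> borel_measurable coins"
      by (rule borel_measurable_indicator)
    then show ?thesis by (simp add: indicator_def)
  qed
  note meas = ind measurable_slot measurable_coins_component measurable_const
  let ?A = "\<lambda>\<omega>. indicator (E (slot n (\<omega> 0) (\<omega> 1)) (slot n (\<omega> 2) (\<omega> 3))) (\<omega> 4) :: ennreal"
  have "emeasure coins {\<omega>. Q (slot n (\<omega> 0) (\<omega> 1)) \<and>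
      \<omega> 4 < T (slot n (\<omega> 0) (\<omega> 1)) (slot n (\<omega> 2) (\<omega> 3))} = (\<integral>\<^sup>+\<omega>. ?A \<omega> \<partial>coins)"
  proof (subst nn_integral_indicator[symmetric])
    have "{\<omega>. Q (slot n (\<omega> 0) (\<omega> 1)) \<and> \<omega> 4 < T (slot n (\<omega> 0) (\<omega> 1)) (slot n (\<omega> 2) (\<omega> 3))} =
        ?A -` {1} \<inter> space coins"
      by (auto simp: E_def split: split_indicator_asm)
    moreover have "?A -` {1} \<inter> space coins \<in> sets coins"
      by (rule measurable_sets[where A = borel]) (intro meas, simp)
    ultimately show "{\<omega>. Q (slot n (\<omega> 0) (\<omega> 1)) \<and>
        \<omega> 4 < T (slot n (\<omega> 0) (\<omega> 1)) (slot n (\<omega> 2) (\<omega> 3))} \<in> sets coins"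
      by (simp only:)
  qed (auto simp: E_def indicator_def intro!: nn_integral_cong)
  also have "\<dots> = (\<integral>\<^sup>+\<omega>. (\<integral>\<^sup>+\<omega>'. indicator (E (slot n (\<omega> 0) (\<omega> 1)) (slot n (\<omega>' 0) (\<omega>' 1))) (\<omega>' 2) \<partial>coins) \<partial>coins)"
    by (rule trans[OF nn_integral_coins_comb_seq[where b = 2]]) (intro meas, simp_all add: comb_seq_def)
  also have "\<dots> = (\<integral>\<^sup>+\<omega>. (\<integral>\<^sup>+\<omega>'. (\<integral>\<^sup>+\<omega>''. indicator (E (slot n (\<omega> 0) (\<omega> 1)) (slot n (\<omega>' 0) (\<omega>' 1))) (\<omega>'' 0)
      \<partial>coins) \<partial>coins) \<partial>coins)"
    by (rule nn_integral_cong, rule trans[OF nn_integral_coins_comb_seq[where b = 2]]) (intro meas, simp_all add: comb_seq_def)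
  also have "\<dots> = (\<integral>\<^sup>+\<omega>. (\<integral>\<^sup>+\<omega>'. ennreal (h (slot n (\<omega> 0) (\<omega> 1)) (slot n (\<omega>' 0) (\<omega>' 1))) \<partial>coins) \<partial>coins)"
    by (rule nn_integral_cong, rule nn_integral_cong, rule trans[OF nn_integral_coins_head])
      (simp_all add: E)
  also have "\<dots> = (\<integral>\<^sup>+\<omega>. (\<Sum>t<2 * n. ennreal (h (slot n (\<omega> 0) (\<omega> 1)) t)) * ennreal (1 / (2 * real n)) \<partial>coins)"
    using n by (intro nn_integral_cong[OF nn_integral_coins_slot])
  also have "\<dots> = (\<Sum>s<2 * n. (\<Sum>t<2 * n. ennreal (h s t)) * ennreal (1 / (2 * real n))) * ennreal (1 / (2 * real n))"
    using n by (rule nn_integral_coins_slot)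
  also have "\<dots> = ennreal ((\<Sum>s<2 * n. (\<Sum>t<2 * n. h s t) * (1 / (2 * real n))) * (1 / (2 * real n)))"
    by (simp add: h sum_nonneg ennreal_mult[symmetric] sum_ennreal del: times_divide_eq_right)
  also have "(\<Sum>s<2 * n. (\<Sum>t<2 * n. h s t) * (1 / (2 * real n))) * (1 / (2 * real n)) =
      (\<Sum>s<2 * n. \<Sum>t<2 * n. h s t) / (4 * (real n)\<^sup>2)"
    by (simp add: sum_divide_distrib[symmetric] power2_eq_square)
  finally show ?thesis by (simp add: h_def)
qed

lemma measurable_rejection:
  fixes T :: "nat \<Rightarrow> nat \<Rightarrow> real" and g :: "nat \<Rightarrow> nat"
  assumes [measurable]: "\<sigma> \<in> M \<rightarrow>\<^sub>M count_space UNIV" "\<tau> \<in> M \<rightarrow>\<^sub>M count_space UNIV" "f \<in> borel_measurable M"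
  shows "(\<lambda>\<omega>. if f \<omega> < T (\<sigma> \<omega>) (\<tau> \<omega>) then Some (g (\<sigma> \<omega>)) else None) \<in> M \<rightarrow>\<^sub>M count_space UNIV"
  by measurable

section \<open>Waiting for the first success\<close>

text \<open>\<open>R_comb_seq\<close> says that \<open>R\<close> reads only the first
  \<open>b\<close> coins: replacing the tail changes nothing. Consecutive blocks of length
  \<open>b\<close> therefore give independent copies of \<open>R\<close>.\<close>

locale trials =
  fixes b :: nat and R :: "(nat \<Rightarrow> real) \<Rightarrow> nat option"
  assumes measurable_R [measurable]: "R \<in> coins \<rightarrow>\<^sub>M count_space UNIV"
    and R_comb_seq: "\<And>\<omega> \<omega>'. R (comb_seq b \<omega> \<omega>') = R \<omega>"
begin

definition trial :: "nat \<Rightarrow> (nat \<Rightarrow> real) \<Rightarrow> nat option" where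
  "trial m \<omega> = R (\<lambda>k. \<omega> (m * b + k))"

definition fails :: "nat \<Rightarrow> (nat \<Rightarrow> real) \<Rightarrow> bool" where
  "fails m \<omega> \<longleftrightarrow> (\<forall>k<m. trial k \<omega> = None)"

text \<open>If no trial succeeds, the \<open>LEAST\<close> is an unspecified number, but every trial
  is then \<open>None\<close>, so the value is \<open>None\<close>, as it should be for a diverging
  run.\<close>

definition first_success :: "(nat \<Rightarrow> real) \<Rightarrow> nat option" where
  "first_success \<omega> = trial (LEAST m. trial m \<omega> \<noteq> None) \<omega>"

text \<open>Trial \<open>m\<close> takes place iff the first \<open>m\<close> trials fail, so this
  sum counts the trials up to and including the first success; it is infinite if there is
  none.\<close>

definition trial_count :: "(nat \<Rightarrow> real) \<Rightarrow> ennreal" where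
  "trial_count \<omega> = (\<Sum>m. indicator {\<omega>. fails m \<omega>} \<omega>)"

lemma measurable_trial [measurable]: "trial m \<in> coins \<rightarrow>\<^sub>M count_space UNIV"
  unfolding trial_def by (rule measurable_compose[OF measurable_coins_shift measurable_R])

lemma pred_fails [measurable]: "Measurable.pred coins (fails m)"
  unfolding fails_def by measurable

lemma measurable_first_success [measurable]: "first_success \<in> coins \<rightarrow>\<^sub>M count_space UNIV"
  unfolding first_success_def by measurable

lemma measurable_trial_count [measurable]: "trial_count \<in> borel_measurable coins"
  unfolding trial_count_def by measurable

lemma trial_0_comb_seq: "trial 0 (comb_seq b \<omega> \<omega>') = R \<omega>"
  by (simp add: trial_def R_comb_seq)

lemma trial_Suc_comb_seq: "trial (Suc m) (comb_seq b \<omega> \<omega>') = trial m \<omega>'"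
  by (simp add: trial_def comb_seq_def add.assoc)

lemma fails_Suc_comb_seq:
  "fails (Suc m) (comb_seq b \<omega> \<omega>') \<longleftrightarrow> R \<omega> = None \<and> fails m \<omega>'"
  by (auto simp: fails_def less_Suc_eq_0_disj trial_0_comb_seq trial_Suc_comb_seq)

text \<open>Splitting off the first block lowers all trial numbers by one and contributes the
  failure of that block as an independent factor, which is the induction step.\<close>

lemma emeasure_fails_and_trial:
  assumes [measurable]: "Measurable.pred (count_space UNIV) Q"
  shows "emeasure coins {\<omega>. fails m \<omega> \<and> Q (trial m \<omega>)} =
    emeasure coins {\<omega>. R \<omega> = None} ^ m * emeasure coins {\<omega>. Q (R \<omega>)}"
proof (induction m)
  case 0
  then show ?case by (simp add: fails_def trial_def)
next
  case (Suc m)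
  have "emeasure coins {\<omega>. fails (Suc m) \<omega> \<and> Q (trial (Suc m) \<omega>)} =
      (\<integral>\<^sup>+\<omega>. indicator {\<omega>. fails (Suc m) \<omega> \<and> Q (trial (Suc m) \<omega>)} \<omega> \<partial>coins)"
    by (rule nn_integral_indicator[symmetric]) measurable
  also have "\<dots> = (\<integral>\<^sup>+\<omega>. (\<integral>\<^sup>+\<omega>'. indicator {\<omega>. fails (Suc m) \<omega> \<and> Q (trial (Suc m) \<omega>)}
      (comb_seq b \<omega> \<omega>') \<partial>coins) \<partial>coins)"
    by (rule nn_integral_coins_comb_seq) measurable
  also have "\<dots> = (\<integral>\<^sup>+\<omega>. (\<integral>\<^sup>+\<omega>'. indicator {\<omega>. R \<omega> = None} \<omega> *
      indicator {\<omega>. fails m \<omega> \<and> Q (trial m \<omega>)} \<omega>' \<partial>coins) \<partial>coins)"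
    by (intro nn_integral_cong)
      (auto simp: fails_Suc_comb_seq trial_Suc_comb_seq split: split_indicator)
  also have "\<dots> = emeasure coins {\<omega>. R \<omega> = None} * emeasure coins {\<omega>. fails m \<omega> \<and> Q (trial m \<omega>)}"
    by (simp add: nn_integral_cmult nn_integral_multc)
  finally show ?case by (simp add: Suc.IH mult.assoc)
qed

lemma first_success_Some_iff:
  "first_success \<omega> = Some i \<longleftrightarrow> (\<exists>m. fails m \<omega> \<and> trial m \<omega> = Some i)"
proof
  assume *: "first_success \<omega> = Some i"
  then show "\<exists>m. fails m \<omega> \<and> trial m \<omega> = Some i"
    unfolding first_success_def fails_def
    by (intro exI[of _ "LEAST m. trial m \<omega> \<noteq> None"]) (blast dest: not_less_Least)
next
  assume "\<exists>m. fails m \<omega> \<and> trial m \<omega> = Some i"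
  then obtain m where m: "fails m \<omega>" "trial m \<omega> = Some i" by blast
  have "(LEAST m. trial m \<omega> \<noteq> None) = m"
    using m by (intro Least_equality) (auto simp: fails_def not_less[symmetric])
  then show "first_success \<omega> = Some i" using m by (simp add: first_success_def)
qed

lemma trial_count_first:
  assumes "fails m \<omega>" "trial m \<omega> \<noteq> None"
  shows "trial_count \<omega> = of_nat (Suc m)"
proof -
  have "fails k \<omega> \<longleftrightarrow> k \<le> m" for k
    using assms unfolding fails_def by (meson linorder_not_le order_less_le_trans)
  then have "trial_count \<omega> = (\<Sum>k. if k \<in> {..m} then 1 else 0)"
    by (simp add: trial_count_def indicator_def of_bool_def)
  also have "\<dots> = (\<Sum>k\<le>m. 1)"
    by (subst suminf_finite[of "{..m}"]) auto
  finally show ?thesis by simp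
qed

lemma trial_count_infinite:
  assumes "\<And>m. trial m \<omega> = None"
  shows "trial_count \<omega> = \<infinity>"
proof -
  have "trial_count \<omega> = (\<Sum>k. 1)"
    using assms by (simp add: trial_count_def fails_def)
  also have "\<dots> = (SUP k. of_nat k)"
    by (subst suminf_eq_SUP) simp
  finally show ?thesis by (simp add: ennreal_SUP_of_nat_eq_top)
qed

section \<open>The geometric law of the waiting time\<close>

context
  fixes p :: real
  assumes p: "0 < p" and success: "emeasure coins {\<omega>. R \<omega> \<noteq> None} = ennreal p"
begin

lemma failure_probability: "emeasure coins {\<omega>. R \<omega> = None} = ennreal (1 - p)" "p \<le> 1"
proof -
  have m: "measure coins {\<omega>. R \<omega> \<noteq> None} = p"
    using success p by (simp add: measure_def)
  have "measure coins (space coins - {\<omega>. R \<omega> \<noteq> None}) = 1 - measure coins {\<omega>. R \<omega> \<noteq> None}"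
    by (rule coins.prob_compl) measurable
  moreover have "space coins - {\<omega>. R \<omega> \<noteq> None} = {\<omega>. R \<omega> = None}" by auto
  ultimately show "emeasure coins {\<omega>. R \<omega> = None} = ennreal (1 - p)"
    using m by (simp add: coins.emeasure_eq_measure)
  show "p \<le> 1" using m coins.prob_le_1 by metis
qed

lemma geometric: "(\<Sum>m. ennreal (1 - p) ^ m) = ennreal (1 / p)"
proof -
  have "(\<Sum>m. ennreal (1 - p) ^ m) = (\<Sum>m. ennreal ((1 - p) ^ m))"
    using failure_probability(2) by (simp add: ennreal_power)
  also have "\<dots> = ennreal (\<Sum>m. (1 - p) ^ m)"
    using failure_probability(2) p by (intro suminf_ennreal2) (auto intro: summable_geometric)
  also have "(\<Sum>m. (1 - p) ^ m) = 1 / p"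
    using failure_probability(2) p by (subst suminf_geometric) auto
  finally show ?thesis .
qed

text \<open>Integrating the indicators term by term gives the tail sum of the probabilities that the
  first \<open>m\<close> trials fail, a geometric series.\<close>

lemma expectation_trial_count: "(\<integral>\<^sup>+\<omega>. trial_count \<omega> \<partial>coins) = ennreal (1 / p)"
proof -
  have "(\<integral>\<^sup>+\<omega>. trial_count \<omega> \<partial>coins) = (\<Sum>m. emeasure coins {\<omega>. fails m \<omega>})"
    unfolding trial_count_def
    by (subst nn_integral_suminf) (simp_all add: sets_coins_Collect pred_fails)
  also have "\<dots> = (\<Sum>m. ennreal (1 - p) ^ m)"
    using emeasure_fails_and_trial[of "\<lambda>_. True"]
    by (simp add: failure_probability)
  finally show ?thesis by (simp add: geometric)
qed

text \<open>The event is split by the number of failures before the success. The geometric series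
  turns \<open>r\<close> into \<open>r / p\<close>, the probability of \<open>i\<close> conditioned
  on success.\<close>

lemma measure_first_success:
  assumes "emeasure coins {\<omega>. R \<omega> = Some i} = ennreal r" "0 \<le> r"
  shows "measure coins {\<omega>. first_success \<omega> = Some i} = r / p"
proof -
  let ?E = "\<lambda>m. {\<omega>. fails m \<omega> \<and> trial m \<omega> = Some i}"
  have disj: "disjoint_family ?E"
  proof -
    have "m = m'" if "fails m \<omega>" "trial m \<omega> = Some i" "fails m' \<omega>" "trial m' \<omega> = Some i" for m m' \<omega>
      using that unfolding fails_def by (metis linorder_neqE_nat option.distinct(1))
    then show ?thesis unfolding disjoint_family_on_def by blast
  qed
  have "{\<omega>. first_success \<omega> = Some i} = (\<Union>m. ?E m)"
    by (auto simp: first_success_Some_iff)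
  then have "emeasure coins {\<omega>. first_success \<omega> = Some i} = (\<Sum>m. emeasure coins (?E m))"
    using disj by (subst suminf_emeasure) (auto simp: sets_coins_Collect)
  also have "\<dots> = (\<Sum>m. ennreal (1 - p) ^ m * ennreal r)"
    using emeasure_fails_and_trial[of "\<lambda>x. x = Some i"] by (simp add: failure_probability assms)
  also have "\<dots> = ennreal (1 / p) * ennreal r"
    by (simp add: geometric)
  also have "\<dots> = ennreal (r / p)"
    using p assms(2) by (simp add: ennreal_mult[symmetric])
  finally show ?thesis using p assms(2) by (simp add: measure_def)
qed

end

end

section \<open>Positive semidefinite matrices\<close>

lemma binary_quadratic_form_nonneg:
  fixes p q r :: real
  assumes "\<And>s t. 0 \<le> s\<^sup>2 * p + 2 * s * t * q + t\<^sup>2 * r"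
  shows "q\<^sup>2 \<le> p * r"
proof -
  have r: "0 \<le> r" using assms[of 0 1] by simp
  show ?thesis
  proof (cases "r = 0")
    case True
    \<comment> \<open>For \<open>r = 0\<close> the form is affine in \<open>t\<close>; at this point
      it takes the value q^2 p - q^2 (p + 1).\<close>
    have "0 \<le> - (q\<^sup>2)"
      using assms[of "-q" "(p + 1) / 2"] True by (simp add: power2_eq_square field_simps)
    then show ?thesis using True by simp
  next
    case False
    \<comment> \<open>Up to scaling, (r, -q) minimizes the form in \<open>t\<close> for fixed
      \<open>s\<close>.\<close>
    have "0 \<le> r * (p * r - q\<^sup>2)"
      using assms[of r "-q"] by (simp add: power2_eq_square algebra_simps)
    then show ?thesis using r False by (simp add: zero_le_mult_iff)
  qed
qed

lemma psd_quadratic_form: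
  assumes A: "A \<in> carrier_mat n n" "psd A" and ij: "i < n" "j < n"
  shows "0 \<le> s\<^sup>2 * A $$ (i, i) + 2 * s * t * A $$ (i, j) + t\<^sup>2 * A $$ (j, j)"
proof -
  \<comment> \<open>This is s e_i + t e_j; written as a sum of two terms it is also correct for
    \<open>i = j\<close>.\<close>
  define x where "x = vec n (\<lambda>k. (if k = i then s else 0) + (if k = j then t else 0))"
  have sym: "A $$ (j, i) = A $$ (i, j)"
    using A ij unfolding psd_def by (metis carrier_matD index_transpose_mat(1))
  have row: "(A *\<^sub>v x) $ k = A $$ (k, i) * s + A $$ (k, j) * t" if "k < n" for k
    using A ij that by (simp add: x_def scalar_prod_def distrib_left sum.distrib if_distrib[of "\<lambda>c. _ * c"]
        cong: if_cong)
  have "scalar_prod x (A *\<^sub>v x) = (\<Sum>k<n. x $ k * (A *\<^sub>v x) $ k)"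
    using A by (simp add: scalar_prod_def atLeast0LessThan del: index_mult_mat_vec)
  also have "\<dots> = (\<Sum>k<n. x $ k * (A $$ (k, i) * s + A $$ (k, j) * t))"
    by (intro sum.cong refl) (simp add: row del: index_mult_mat_vec)
  also have "\<dots> = s * (A $$ (i, i) * s + A $$ (i, j) * t) + t * (A $$ (j, i) * s + A $$ (j, j) * t)"
    using ij by (simp add: x_def distrib_right sum.distrib if_distrib[of "\<lambda>c. c * _"]
        cong: if_cong)
  finally have "scalar_prod x (A *\<^sub>v x) = s * (A $$ (i, i) * s + A $$ (i, j) * t) +
    t * (A $$ (j, i) * s + A $$ (j, j) * t)" .
  moreover have "0 \<le> scalar_prod x (A *\<^sub>v x)"
    using A unfolding psd_def by (auto simp: x_def)
  ultimately show ?thesis by (simp add: sym power2_eq_square algebra_simps)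
qed

section \<open>Cutting the diagonal into slots\<close>

text \<open>The consequences of semidefiniteness on which the sampler rests. Entries outside the
  matrix are 0, so the cutting of the diagonal may run past the last row.\<close>

locale table =
  fixes n :: nat and a :: "nat \<Rightarrow> nat \<Rightarrow> real"
  assumes n: "1 \<le> n"
    and diag_nonneg: "\<And>i. 0 \<le> a i i"
    and minor: "\<And>i j. (a i j)\<^sup>2 \<le> a i i * a j j"
    and outside: "\<And>i j. n \<le> i \<or> n \<le> j \<Longrightarrow> a i j = 0"
    and trace_pos: "0 < (\<Sum>i<n. a i i)"

text \<open>For the positive trace: a vanishing trace forces all diagonal entries to be 0, and the
  minors then force all other entries to be 0.\<close>

lemma psd_table:
  assumes n: "1 \<le> n" and A: "A \<in> carrier_mat n n" "psd A" and nz: "A \<noteq> 0\<^sub>m n n"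
  shows "table n (entry A)"
proof
  have entry: "entry A i j = (if i < n \<and> j < n then A $$ (i, j) else 0)" for i j
    using A by (simp add: entry_def)
  show diag: "0 \<le> entry A i i" for i
    using psd_quadratic_form[OF A, of i i 1 0] by (simp add: entry)
  show minor: "(entry A i j)\<^sup>2 \<le> entry A i i * entry A j j" for i j
    using binary_quadratic_form_nonneg[OF psd_quadratic_form[OF A, of i j]] by (simp add: entry)
  show "entry A i j = 0" if "n \<le> i \<or> n \<le> j" for i j
    using that by (auto simp: entry)
  show "0 < (\<Sum>i<n. entry A i i)"
  proof (rule ccontr)
    assume "\<not> 0 < (\<Sum>i<n. entry A i i)"
    then have "(\<Sum>i<n. entry A i i) = 0"
      using diag sum_nonneg[of "{..<n}" "\<lambda>i. entry A i i"] by fastforce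
    then have "entry A i i = 0" if "i < n" for i
      using diag that by (subst (asm) sum_nonneg_eq_0_iff) auto
    then have "entry A i j = 0" if "i < n" "j < n" for i j
      using minor[of i j] that by simp
    then have "A = 0\<^sub>m n n"
      using A by (intro eq_matI) (auto simp: entry)
    then show False using nz by simp
  qed
qed (fact n)

context table
begin

section \<open>Filling the slots one by one\<close>

definition mean :: real where
  "mean = (\<Sum>i<n. a i i) / real n"

lemma mean_pos: "0 < mean"
  using trace_pos n by (simp add: mean_def)

lemma sum_diag_le: "(\<Sum>j\<le>i. a j j) \<le> real n * mean"
proof -
  have "(\<Sum>j\<le>i. a j j) = (\<Sum>j\<in>{..i} \<inter> {..<n}. a j j)"
    using outside by (intro sum.mono_neutral_right) (auto simp: not_less)
  also have "\<dots> \<le> (\<Sum>j<n. a j j)"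
    by (rule sum_mono2) (auto simp: diag_nonneg)
  also have "\<dots> = real n * mean" using n by (simp add: mean_def)
  finally show ?thesis .
qed

text \<open>
  The diagonal is cut into slots of mass at most \<open>mean\<close>. Slot \<open>s\<close> belongs to index \<open>idx s\<close> and has
  mass \<open>mean * v s * a (idx s) (idx s)\<close>; the first \<open>k\<close> slots use up the diagonal entries before \<open>i\<close>,
  and the amount \<open>r\<close> of \<open>a i i\<close> is left. Exactly \<open>k - i\<close> of these slots are full.
\<close>

definition filling :: "nat \<Rightarrow> nat \<Rightarrow> real \<Rightarrow> (nat \<Rightarrow> nat) \<Rightarrow> (nat \<Rightarrow> real) \<Rightarrow> bool" where
  "filling k i r idx v \<longleftrightarrow> i \<le> k \<and> 0 \<le> r \<and> r \<le> a i i \<and>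
     real (k - i) * mean + r \<le> (\<Sum>j\<le>i. a j j) \<and>
     (\<forall>s. 0 \<le> v s \<and> v s * a (idx s) (idx s) \<le> 1) \<and>
     (\<forall>j. (\<Sum>s<k. if idx s = j then v s else 0) * a j j =
        (if j < i then a j j else if j = i then a i i - r else 0) / mean)"

lemma filling_empty: "filling 0 0 (a 0 0) idx (\<lambda>_. 0)"
  by (auto simp: filling_def diag_nonneg)

lemma filling_add_slot_weight:
  "(\<Sum>s<Suc k. if (idx(k := i)) s = j then (v(k := w)) s else 0) =
    (\<Sum>s<k. if idx s = j then v s else 0) + (if i = j then w else (0::real))"
  by (auto intro!: sum.cong)

text \<open>The new value equals \<open>1 / a i i\<close>, giving the slot mass \<open>mean\<close>;
  it is kept as the two divisions that the program performs. One more full slot is paid for by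
  lowering \<open>r\<close> by \<open>mean\<close>.\<close>

lemma filling_full_slot:
  assumes "filling k i r idx v" "mean < r"
  shows "filling (Suc k) i (r - mean) (idx(k := i)) (v(k := mean / a i i / mean))"
proof -
  have pos: "0 < a i i" "0 < mean" using assms mean_pos by (auto simp: filling_def)
  have w: "mean / a i i / mean * a i i = 1" "0 \<le> mean / a i i / mean" using pos by auto
  have "(\<Sum>s<Suc k. if (idx(k := i)) s = j then (v(k := mean / a i i / mean)) s else 0) * a j j =
        (if j < i then a j j else if j = i then a i i - (r - mean) else 0) / mean" for j
    unfolding filling_add_slot_weight distrib_right
    using assms w(1) pos by (auto simp: filling_def diff_divide_distrib add_divide_distrib)
  moreover have "real (Suc k - i) * mean + (r - mean) = real (k - i) * mean + r"
    using assms by (simp add: filling_def Suc_diff_le algebra_simps)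
  ultimately show ?thesis
    using assms w pos unfolding filling_def by auto
qed

text \<open>The rest of row \<open>i\<close> gets its own slot, and \<open>k\<close> and
  \<open>i\<close> advance together, so \<open>k - i\<close> stays the same. If
  \<open>a i i = 0\<close>, also past the last row, division by zero gives the slot value 0, as
  desired.\<close>

lemma filling_last_slot:
  assumes "filling k i r idx v" "r \<le> mean"
  shows "filling (Suc k) (Suc i) (a (Suc i) (Suc i)) (idx(k := i)) (v(k := r / a i i / mean))"
proof -
  have r: "0 \<le> r" "r \<le> a i i" "0 < mean" using assms mean_pos by (auto simp: filling_def)
  have w: "r / a i i / mean * a i i = r / mean" "0 \<le> r / a i i / mean"
    using r diag_nonneg[of i] by (cases "a i i = 0"; simp)+
  have "(\<Sum>s<Suc k. if (idx(k := i)) s = j then (v(k := r / a i i / mean)) s else 0) * a j j =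
        (if j < Suc i then a j j else if j = Suc i then a (Suc i) (Suc i) - a (Suc i) (Suc i) else 0) / mean" for j
    unfolding filling_add_slot_weight distrib_right
    using assms w(1) r by (auto simp: filling_def diff_divide_distrib add_divide_distrib)
  moreover have "r / a i i / mean * a i i \<le> 1" unfolding w(1) using assms(2) r by simp
  ultimately show ?thesis
    using assms w r diag_nonneg unfolding filling_def by auto
qed

section \<open>Acceptance thresholds and their sums\<close>

context
  fixes idx :: "nat \<Rightarrow> nat" and v :: "nat \<Rightarrow> real"
begin

definition weight :: "nat \<Rightarrow> real" where
  "weight j = (\<Sum>s<2 * n. if idx s = j then v s else 0)"

text \<open>Slot \<open>s\<close> is filled to the fraction \<open>v s * a (idx s) (idx s)\<close>.
  Multiplying two such fractions by A_ji^2 / (A_ii A_jj) cancels the diagonal entries and leaves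
  this product, so a single comparison decides on both slots and the entry.\<close>

definition threshold :: "nat \<Rightarrow> nat \<Rightarrow> real" where
  "threshold s t = a (idx t) (idx s) * a (idx t) (idx s) * v s * v t"

context
  fixes i r
  assumes filling: "filling (2 * n) i r idx v"
begin

text \<open>If \<open>i < n\<close>, at least \<open>n + 1\<close> of the \<open>2 * n\<close> slots
  would be full, with total mass above the trace \<open>real n * mean\<close>.\<close>

lemma filling_complete: "n \<le> i"
proof (rule ccontr)
  assume "\<not> n \<le> i"
  then have "real n + 1 \<le> real (2 * n - i)" by simp
  then have "(real n + 1) * mean \<le> real (2 * n - i) * mean"
    using mean_pos by (intro mult_right_mono) auto
  also have "\<dots> \<le> real n * mean"
    using filling sum_diag_le[of i] unfolding filling_def by linarith
  finally show False using mean_pos by (simp add: algebra_simps)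
qed

text \<open>Row \<open>j\<close> is cut up completely, so its slots have total mass
  \<open>mean * weight j * a j j = a j j\<close>. The weight is thus the same for all rows with
  nonzero diagonal entry.\<close>

lemma weight: "j < n \<Longrightarrow> a j j \<noteq> 0 \<Longrightarrow> weight j = 1 / mean"
proof -
  assume j: "j < n" "a j j \<noteq> 0"
  have "weight j * a j j = 1 / mean * a j j"
    using filling filling_complete j(1) by (auto simp: filling_def weight_def)
  then show ?thesis using mult_right_cancel[OF j(2)] by blast
qed

lemma sum_slots:
  assumes "\<And>j. n \<le> j \<Longrightarrow> f j = 0"
  shows "(\<Sum>s<2 * n. v s * f (idx s)) = (\<Sum>j<n. weight j * f j)"
proof -
  have "(\<Sum>j<n. weight j * f j) = (\<Sum>j<n. \<Sum>s<2 * n. if idx s = j then v s * f j else 0)"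
    by (auto simp: weight_def sum_distrib_right intro!: sum.cong)
  also have "\<dots> = (\<Sum>s<2 * n. \<Sum>j<n. if idx s = j then v s * f j else 0)"
    by (rule sum.swap)
  also have "\<dots> = (\<Sum>s<2 * n. v s * f (idx s))"
    using assms by (intro sum.cong) (auto simp: not_less)
  finally show ?thesis by simp
qed

text \<open>The minor inequality replaces the squared entry by two diagonal entries, which pair with
  \<open>v t\<close> and \<open>v s\<close> to form two filling fractions, each at most 1.\<close>

lemma threshold_bounds: "0 \<le> threshold s t" "threshold s t \<le> 1"
proof -
  have v: "0 \<le> v s" "v s * a (idx s) (idx s) \<le> 1" for s
    using filling by (auto simp: filling_def)
  show "0 \<le> threshold s t" using v by (simp add: threshold_def)
  have "threshold s t = (a (idx t) (idx s))\<^sup>2 * (v s * v t)"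
    by (simp add: threshold_def power2_eq_square)
  also have "\<dots> \<le> (a (idx t) (idx t) * a (idx s) (idx s)) * (v s * v t)"
    by (intro mult_right_mono minor) (simp add: v)
  also have "\<dots> = (v t * a (idx t) (idx t)) * (v s * a (idx s) (idx s))" by simp
  also have "\<dots> \<le> 1 * 1"
    by (intro mult_mono v) (auto simp: v diag_nonneg)
  finally show "threshold s t \<le> 1" by simp
qed

lemma sum_threshold_index:
  assumes "i0 < n"
  shows "(\<Sum>s<2 * n. \<Sum>t<2 * n. if idx s = i0 then threshold s t else 0) = (\<Sum>j<n. (a j i0)\<^sup>2) / mean\<^sup>2"
proof -
  have "(\<Sum>s<2 * n. \<Sum>t<2 * n. if idx s = i0 then threshold s t else 0) =
      (\<Sum>s<2 * n. if idx s = i0 then v s * (\<Sum>t<2 * n. v t * (a (idx t) i0)\<^sup>2) else 0)"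
    by (auto intro!: sum.cong simp: threshold_def sum_distrib_left power2_eq_square)
  also have "\<dots> = weight i0 * (\<Sum>t<2 * n. v t * (a (idx t) i0)\<^sup>2)"
    by (auto simp: weight_def sum_distrib_right intro!: sum.cong)
  also have "\<dots> = weight i0 * (\<Sum>j<n. weight j * (a j i0)\<^sup>2)"
    by (subst sum_slots[of "\<lambda>j. (a j i0)\<^sup>2"]) (auto simp: outside)
  also have "\<dots> = (\<Sum>j<n. weight i0 * weight j * (a j i0)\<^sup>2)"
    by (simp add: sum_distrib_left mult.assoc)
  also have "\<dots> = (\<Sum>j<n. (a j i0)\<^sup>2 / mean\<^sup>2)"
  proof (rule sum.cong)
    fix j assume "j \<in> {..<n}"
    then have j: "j < n" by simp
    show "weight i0 * weight j * (a j i0)\<^sup>2 = (a j i0)\<^sup>2 / mean\<^sup>2"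
    proof (cases "a i0 i0 = 0 \<or> a j j = 0")
      \<comment> \<open>Here the weights may be unknown, but the minor inequality makes the entry
        itself vanish.\<close>
      case True
      then have "a j i0 = 0" using minor[of j i0] by auto
      then show ?thesis by simp
    next
      case False
      then show ?thesis using weight j assms by (simp add: power2_eq_square)
    qed
  qed simp
  finally show ?thesis by (simp add: sum_divide_distrib)
qed

lemma sum_threshold:
  "(\<Sum>s<2 * n. \<Sum>t<2 * n. threshold s t) = (\<Sum>i<n. \<Sum>j<n. (a j i)\<^sup>2) / mean\<^sup>2"
proof -
  have "(\<Sum>s<2 * n. \<Sum>t<2 * n. threshold s t) =
      (\<Sum>s<2 * n. \<Sum>i<n. \<Sum>t<2 * n. if idx s = i then threshold s t else 0)"
  proof (rule sum.cong)
    fix s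
    show "(\<Sum>t<2 * n. threshold s t) = (\<Sum>i<n. \<Sum>t<2 * n. if idx s = i then threshold s t else 0)"
    proof (cases "idx s < n")
      case True
      have "(\<Sum>i<n. \<Sum>t<2 * n. if idx s = i then threshold s t else 0) =
          (\<Sum>i<n. if idx s = i then \<Sum>t<2 * n. threshold s t else 0)"
        by (rule sum.cong) auto
      then show ?thesis using True by simp
    next
      case False
      then show ?thesis by (auto simp: threshold_def outside)
    qed
  qed simp
  also have "\<dots> = (\<Sum>i<n. \<Sum>s<2 * n. \<Sum>t<2 * n. if idx s = i then threshold s t else 0)"
    by (rule sum.swap)
  also have "\<dots> = (\<Sum>i<n. (\<Sum>j<n. (a j i)\<^sup>2) / mean\<^sup>2)"
    by (intro sum.cong sum_threshold_index) auto
  finally show ?thesis by (simp add: sum_divide_distrib)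
qed

end

end

text \<open>Cauchy-Schwarz for the diagonal against the all-ones vector, after which the
  off-diagonal squares are added. It bounds the success probability of a round from below by
  1/(4n).\<close>

lemma trace_square_le: "(real n * mean)\<^sup>2 \<le> real n * (\<Sum>i<n. \<Sum>j<n. (a j i)\<^sup>2)"
proof -
  have "(real n * mean)\<^sup>2 = (\<Sum>i<n. a i i)\<^sup>2" using n by (simp add: mean_def)
  also have "\<dots> \<le> real n * (\<Sum>i<n. (a i i)\<^sup>2)"
    using Cauchy_Schwarz_ineq_sum[of "\<lambda>i. a i i" "\<lambda>_. 1" "{..<n}"] by (simp add: mult.commute)
  also have "\<dots> \<le> real n * (\<Sum>i<n. \<Sum>j<n. (a j i)\<^sup>2)"
    by (intro mult_left_mono sum_mono member_le_sum) auto
  finally show ?thesis .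
qed

end

section \<open>The program\<close>

text \<open>
  Index registers: 0 dimension, 1 row being cut and later the candidate output, 2 constant 1,
  3 number of slots, 4 next slot, 5 drawn slot, 6 second candidate, 7 constant 0. Real registers:
  0 trace and later the mean, 1 the dimension, 2 the rest of the current diagonal entry, 3 constant 1,
  4 current diagonal entry, 5 slot value, 6 constant 1/2, 7 acceptance threshold, 8 uniform number,
  9 coin, 10 and 11 slot values. Both branches of \<open>draw_slot\<close> cost the same, so every round has the
  same cost and the costs are affine functions of the number of rounds, hence measurable.
\<close>

definition trace_body :: com where
  "trace_body = instrs [Query 2 1 1, RAdd 0 0 2, RAdd 1 1 3, IAdd 1 1 2]"

definition fill_body :: com where
  "fill_body = Seq (Do (IStore 4 1)) (Seq
    (If (RLess 0 2)
      (instrs [RDiv 5 0 4, RDiv 5 5 0, RStore 4 5, RSub 2 2 0])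
      (instrs [RDiv 5 2 4, RDiv 5 5 0, RStore 4 5, IAdd 1 1 2, Query 2 1 1, RMove 4 2]))
    (Do (IAdd 4 4 2)))"

text \<open>The last two constants set threshold and uniform number to 0, so that the test
  \<open>RLeq 7 8\<close> holds at first and the rejection loop is entered.\<close>

definition preparation :: com where
  "preparation = Seq (instrs [IConst 2 1, RConst 3 1, IAdd 3 0 0])
    (Seq (While (ILess 1 0) trace_body)
    (Seq (instrs [RDiv 0 0 1, IConst 1 0, Query 2 1 1, RMove 4 2])
    (Seq (While (ILess 4 3) fill_body)
    (instrs [RConst 6 2, RDiv 6 3 6, RConst 7 0, RConst 8 0]))))"

definition draw_slot :: com where
  "draw_slot = Seq (instrs [DrawIndex 5, Draw 9])
    (If (RLess 9 6) (instrs [IAdd 5 5 0]) (instrs [IAdd 5 5 7]))"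

definition trial_body :: com where
  "trial_body = Seq draw_slot (Seq (instrs [ILoad 1 5, RLoad 10 5])
    (Seq draw_slot (instrs [ILoad 6 5, RLoad 11 5, Query 7 6 1,
      RMul 7 7 7, RMul 7 7 10, RMul 7 7 11, Draw 8])))"

definition sampler :: com where
  "sampler = Seq preparation (Seq (While (RLeq 7 8) trial_body) (Do (IMove 0 1)))"

lemma loop_free_bodies [simp]:
  "loop_free trace_body" "loop_free fill_body" "loop_free trial_body"
  by (simp_all add: trace_body_def fill_body_def trial_body_def draw_slot_def)

lemma draw_free_preparation: "draw_free preparation"
  by (simp add: preparation_def trace_body_def fill_body_def)

lemmas machine_simps = tick_def set_ireg_def set_rreg_def

section \<open>Correctness and cost of the preparation\<close>

context table
begin

definition trace_inv :: "nat \<Rightarrow> state \<Rightarrow> bool" where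
  "trace_inv k s \<longleftrightarrow> ireg s 0 = n \<and> ireg s 1 = k \<and> ireg s 2 = 1 \<and> ireg s 3 = 2 * n \<and>
    ireg s 4 = 0 \<and> ireg s 7 = 0 \<and> rreg s 0 = (\<Sum>j<k. a j j) \<and> rreg s 1 = real k \<and> rreg s 3 = 1 \<and>
    rmem s = (\<lambda>_. 0) \<and> pos s = 0 \<and> ops s = 3 + 5 * k \<and> queries s = k"

lemma trace_inv_step:
  "k < n \<Longrightarrow> trace_inv k s \<Longrightarrow>
    holds (ILess 1 0) s \<and> trace_inv (Suc k) (run n a \<omega> trace_body (tick s))"
  by (simp add: trace_inv_def trace_body_def machine_simps)

text \<open>The costs are upper bounds because the branches of \<open>fill_body\<close> differ: with
  its test an iteration costs 8 or 10 operations, and only the second kind makes a query.\<close>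

definition fill_inv :: "nat \<Rightarrow> state \<Rightarrow> bool" where
  "fill_inv k s \<longleftrightarrow> ireg s 0 = n \<and> ireg s 2 = 1 \<and> ireg s 3 = 2 * n \<and> ireg s 4 = k \<and>
    ireg s 7 = 0 \<and> rreg s 0 = mean \<and> rreg s 3 = 1 \<and> rreg s 4 = a (ireg s 1) (ireg s 1) \<and>
    filling k (ireg s 1) (rreg s 2) (imem s) (rmem s) \<and>
    pos s = 0 \<and> ops s \<le> 8 + 5 * n + 10 * k \<and> queries s \<le> n + 1 + k"

lemma run_fill_body_full:
  fixes \<omega>
  assumes "rreg s 0 < rreg s 2"
  defines "t \<equiv> run n a \<omega> fill_body (tick s)"
  shows "ireg t = (ireg s)(4 := ireg s 4 + ireg s 2)"
    "rreg t = (rreg s)(5 := rreg s 0 / rreg s 4 / rreg s 0, 2 := rreg s 2 - rreg s 0)"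
    "imem t = (imem s)(ireg s 4 := ireg s 1)"
    "rmem t = (rmem s)(ireg s 4 := rreg s 0 / rreg s 4 / rreg s 0)"
    "pos t = pos s" "ops t = ops s + 8" "queries t = queries s"
  using assms(1) by (simp_all add: t_def fill_body_def machine_simps)

lemma run_fill_body_last:
  fixes \<omega>
  assumes "\<not> rreg s 0 < rreg s 2"
  defines "t \<equiv> run n a \<omega> fill_body (tick s)"
  defines "i \<equiv> ireg s 1 + ireg s 2"
  shows "ireg t = (ireg s)(1 := i, 4 := ireg s 4 + ireg s 2)"
    "rreg t = (rreg s)(5 := rreg s 2 / rreg s 4 / rreg s 0, 2 := a i i, 4 := a i i)"
    "imem t = (imem s)(ireg s 4 := ireg s 1)"
    "rmem t = (rmem s)(ireg s 4 := rreg s 2 / rreg s 4 / rreg s 0)"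
    "pos t = pos s" "ops t = ops s + 10" "queries t = queries s + 1"
  using assms(1) by (simp_all add: t_def i_def fill_body_def machine_simps)

lemma fill_inv_step:
  assumes "k < 2 * n" "fill_inv k s"
  shows "holds (ILess 4 3) s \<and> fill_inv (Suc k) (run n a \<omega> fill_body (tick s))"
proof (cases "mean < rreg s 2")
  case True
  then have *: "rreg s 0 < rreg s 2" using assms(2) by (simp add: fill_inv_def)
  show ?thesis
    using assms filling_full_slot[OF _ True, of k "ireg s 1" "imem s" "rmem s"]
    unfolding fill_inv_def by (simp add: run_fill_body_full[OF *] del: divide_divide_eq_left)
next
  case False
  then have *: "\<not> rreg s 0 < rreg s 2" using assms(2) by (simp add: fill_inv_def)
  show ?thesis
    using assms filling_last_slot[of k "ireg s 1" "rreg s 2" "imem s" "rmem s"] False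
    unfolding fill_inv_def by (simp add: run_fill_body_last[OF *])
qed

definition prepared :: "state \<Rightarrow> bool" where
  "prepared s \<longleftrightarrow> ireg s 0 = n \<and> ireg s 7 = 0 \<and> rreg s 6 = 1 / 2 \<and> rreg s 7 = 0 \<and> rreg s 8 = 0 \<and>
    (\<exists>i r. filling (2 * n) i r (imem s) (rmem s)) \<and>
    pos s = 0 \<and> ops s \<le> 13 + 25 * n \<and> queries s \<le> 1 + 3 * n"

lemma exec_preparation: "\<exists>s. prepared s \<and> (\<forall>\<omega>. exec n a \<omega> preparation (initial n) s)"
proof -
  fix \<omega>
  let ?s1 = "run n a \<omega> (instrs [IConst 2 1, RConst 3 1, IAdd 3 0 0]) (initial n)"
  have "trace_inv 0 ?s1"
    by (simp add: trace_inv_def initial_def machine_simps)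
  then have "\<exists>t. trace_inv n t \<and> exec n a \<omega> (While (ILess 1 0) trace_body) ?s1 (tick t)"
    by (intro exec_While_count trace_inv_step loop_free_bodies) (simp_all add: trace_inv_def)
  then obtain s2 where s2: "trace_inv n s2" "exec n a \<omega> (While (ILess 1 0) trace_body) ?s1 (tick s2)"
    by blast
  let ?s3 = "run n a \<omega> (instrs [RDiv 0 0 1, IConst 1 0, Query 2 1 1, RMove 4 2]) (tick s2)"
  have "fill_inv 0 ?s3"
    using s2(1) filling_empty by (simp add: fill_inv_def trace_inv_def mean_def machine_simps)
  then have "\<exists>t. fill_inv (2 * n) t \<and> exec n a \<omega> (While (ILess 4 3) fill_body) ?s3 (tick t)"
    by (intro exec_While_count fill_inv_step loop_free_bodies) (simp_all add: fill_inv_def)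
  then obtain s4 where s4: "fill_inv (2 * n) s4" "exec n a \<omega> (While (ILess 4 3) fill_body) ?s3 (tick s4)"
    by blast
  let ?s5 = "run n a \<omega> (instrs [RConst 6 2, RDiv 6 3 6, RConst 7 0, RConst 8 0]) (tick s4)"
  have "prepared ?s5"
    using s4(1) by (auto simp: fill_inv_def prepared_def machine_simps)
  moreover have "exec n a \<omega> preparation (initial n) ?s5"
    unfolding preparation_def
    by (intro exec.Seq[OF exec_run] exec.Seq[OF s2(2)] exec.Seq[OF s4(2)] exec_run) simp_all
  ultimately show ?thesis
    using exec_draw_free draw_free_preparation by blast
qed

end

section \<open>The rounds of the rejection loop\<close>

lemma run_draw_slot:
  assumes "ireg s 0 = n" "ireg s 7 = 0" "rreg s 6 = 1 / 2"
  shows "run n a \<omega> draw_slot s =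
    s\<lparr>ireg := (ireg s)(5 := slot n (\<omega> (pos s)) (\<omega> (Suc (pos s)))),
      rreg := (rreg s)(9 := \<omega> (Suc (pos s))), pos := pos s + 2, ops := ops s + 4\<rparr>"
  using assms by (simp add: draw_slot_def slot_def machine_simps)

text \<open>A round uses 2 + 2 + 1 coins. Its 18 operations are the loop test, four for each drawn
  slot, and nine further instructions.\<close>

lemma run_trial_body:
  fixes n a \<omega>
  assumes "ireg s 0 = n" "ireg s 7 = 0" "rreg s 6 = 1 / 2"
  defines "\<sigma> \<equiv> slot n (\<omega> (pos s)) (\<omega> (pos s + 1))"
  defines "\<tau> \<equiv> slot n (\<omega> (pos s + 2)) (\<omega> (pos s + 3))"
  defines "t \<equiv> run n a \<omega> trial_body (tick s)"
  shows "ireg t 0 = n" "ireg t 7 = 0" "rreg t 6 = 1 / 2" "imem t = imem s" "rmem t = rmem s"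
    "pos t = pos s + 5" "ops t = ops s + 18" "queries t = queries s + 1"
    "ireg t 1 = imem s \<sigma>" "rreg t 8 = \<omega> (pos s + 4)"
    "rreg t 7 = a (imem s \<tau>) (imem s \<sigma>) * a (imem s \<tau>) (imem s \<sigma>) * rmem s \<sigma> * rmem s \<tau>"
  using assms
  by (simp_all add: t_def \<sigma>_def \<tau>_def trial_body_def run_draw_slot machine_simps numeral_eq_Suc)

context table
begin

definition round_result :: "(nat \<Rightarrow> nat) \<Rightarrow> (nat \<Rightarrow> real) \<Rightarrow> (nat \<Rightarrow> real) \<Rightarrow> nat option" where
  "round_result idx v \<omega> =
    (if \<omega> 4 < threshold idx v (slot n (\<omega> 0) (\<omega> 1)) (slot n (\<omega> 2) (\<omega> 3))
     then Some (idx (slot n (\<omega> 0) (\<omega> 1))) else None)"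

lemma trials_round_result: "trials 5 (round_result idx v)"
proof
  show "round_result idx v \<in> coins \<rightarrow>\<^sub>M count_space UNIV"
    unfolding round_result_def
    by (rule measurable_rejection; (rule measurable_slot)?; rule measurable_coins_component)
qed (simp add: round_result_def comb_seq_def)

context
  fixes s0
  assumes prepared: "prepared s0" and exec_s0: "\<And>\<omega>. exec n a \<omega> preparation (initial n) s0"
begin

interpretation trials 5 "round_result (imem s0) (rmem s0)"
  by (rule trials_round_result)

text \<open>The iteration goes on past an acceptance, so that every trial number has its state,
  whether or not the run gets there.\<close>

abbreviation rounds :: "(nat \<Rightarrow> real) \<Rightarrow> nat \<Rightarrow> state" where
  "rounds \<omega> k \<equiv> ((\<lambda>s. run n a \<omega> trial_body (tick s)) ^^ k) s0"

lemma rounds_invariant: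
  "ireg (rounds \<omega> k) 0 = n \<and> ireg (rounds \<omega> k) 7 = 0 \<and> rreg (rounds \<omega> k) 6 = 1 / 2 \<and>
    imem (rounds \<omega> k) = imem s0 \<and> rmem (rounds \<omega> k) = rmem s0 \<and> pos (rounds \<omega> k) = k * 5 \<and>
    ops (rounds \<omega> k) = ops s0 + 18 * k \<and> queries (rounds \<omega> k) = queries s0 + k"
proof (induction k)
  case 0
  then show ?case using prepared by (simp add: prepared_def)
next
  case (Suc k)
  then show ?case using run_trial_body[of "rounds \<omega> k" n a \<omega>] by simp
qed

lemma rounds_Suc:
  "holds (RLeq 7 8) (rounds \<omega> (Suc k)) \<longleftrightarrow> trial k \<omega> = None"
  "trial k \<omega> = Some i \<Longrightarrow> ireg (rounds \<omega> (Suc k)) 1 = i"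
  using run_trial_body[of "rounds \<omega> k" n a \<omega>] rounds_invariant[where \<omega> = \<omega> and k = k]
  by (auto simp: trial_def round_result_def threshold_def not_less split: if_splits)

text \<open>The test before round 0 succeeds by initialization, and each later test reports the
  preceding trial; hence \<open>Suc m\<close> tests correspond to \<open>m\<close> trials.\<close>

lemma holds_all_rounds_iff: "(\<forall>k<Suc m. holds (RLeq 7 8) (rounds \<omega> k)) \<longleftrightarrow> fails m \<omega>"
proof -
  have "holds (RLeq 7 8) (rounds \<omega> 0)" using prepared by (simp add: prepared_def)
  then show ?thesis
    unfolding fails_def using rounds_Suc(1) by (auto simp: less_Suc_eq_0_disj simp del: funpow.simps)
qed

text \<open>Success in trial \<open>m\<close> means \<open>Suc m\<close> rounds; the additional 2
  operations are the failing test and the final move.\<close>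

lemma exec_sampler:
  assumes "fails m \<omega>" "trial m \<omega> = Some i"
  shows "\<exists>t. exec n a \<omega> sampler (initial n) t \<and> ireg t 0 = i \<and>
    ops t = ops s0 + 2 + 18 * Suc m \<and> queries t = queries s0 + Suc m"
proof -
  let ?s = "rounds \<omega> (Suc m)"
  have "exec n a \<omega> (While (RLeq 7 8) trial_body) s0 (tick ?s)"
    unfolding exec_While_iff[OF loop_free_bodies(3)]
    using assms holds_all_rounds_iff rounds_Suc(1)
    by (intro exI[of _ "Suc m"]) (simp del: funpow.simps)
  then have "exec n a \<omega> sampler (initial n) (tick (effect n a \<omega> (IMove 0 1) (tick ?s)))"
    unfolding sampler_def by (rule exec.Seq[OF exec_s0 exec.Seq[OF _ exec.Do]])
  moreover have "ireg (tick (effect n a \<omega> (IMove 0 1) (tick ?s))) 0 = i"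
    using rounds_Suc(2)[OF assms(2)] by (simp add: machine_simps del: funpow.simps)
  moreover have "ops (tick (effect n a \<omega> (IMove 0 1) (tick ?s))) = ops s0 + 2 + 18 * Suc m"
    "queries (tick (effect n a \<omega> (IMove 0 1) (tick ?s))) = queries s0 + Suc m"
    using rounds_invariant[where \<omega> = \<omega> and k = "Suc m"]
    by (simp_all add: machine_simps del: funpow.simps)
  ultimately show ?thesis by blast
qed

text \<open>A terminating run left the loop through an acceptance. Read contrapositively, the
  program diverges when no trial succeeds.\<close>

lemma exec_sampler_trial:
  assumes "exec n a \<omega> sampler (initial n) t"
  shows "\<exists>m. fails m \<omega> \<and> trial m \<omega> \<noteq> None"
proof -
  obtain s u where "exec n a \<omega> preparation (initial n) s" "exec n a \<omega> (While (RLeq 7 8) trial_body) s u"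
    using assms unfolding sampler_def exec_Seq_iff by blast
  then have "exec n a \<omega> (While (RLeq 7 8) trial_body) s0 u"
    using exec_deterministic exec_s0 by blast
  then obtain m where m: "\<forall>k<m. holds (RLeq 7 8) (rounds \<omega> k)" "\<not> holds (RLeq 7 8) (rounds \<omega> m)"
    unfolding exec_While_iff[OF loop_free_bodies(3)] by blast
  have "m \<noteq> 0" using m(2) prepared by (intro notI) (simp add: prepared_def)
  then obtain m' where "m = Suc m'" by (cases m) auto
  then show ?thesis
    using m holds_all_rounds_iff rounds_Suc(1) by blast
qed

text \<open>The denominator is the square of twice the trace; its factor 4 is the price of drawing
  two slots uniformly among \<open>2 * n\<close>.\<close>

lemma round_success_probability:
  "emeasure coins {\<omega>. round_result (imem s0) (rmem s0) \<omega> \<noteq> None} =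
    ennreal ((\<Sum>i<n. \<Sum>j<n. (a j i)\<^sup>2) / (2 * real n * mean)\<^sup>2)"
  "i < n \<Longrightarrow> emeasure coins {\<omega>. round_result (imem s0) (rmem s0) \<omega> = Some i} =
    ennreal ((\<Sum>j<n. (a j i)\<^sup>2) / (2 * real n * mean)\<^sup>2)"
proof -
  let ?T = "threshold (imem s0) (rmem s0)"
  obtain i0 r where f: "filling (2 * n) i0 r (imem s0) (rmem s0)"
    using prepared by (auto simp: prepared_def)
  note accept = emeasure_slots_accept[where T = ?T, OF n threshold_bounds[OF f]]
  have "{\<omega>. round_result (imem s0) (rmem s0) \<omega> \<noteq> None} =
      {\<omega>. True \<and> \<omega> 4 < ?T (slot n (\<omega> 0) (\<omega> 1)) (slot n (\<omega> 2) (\<omega> 3))}"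
    by (auto simp: round_result_def)
  then show "emeasure coins {\<omega>. round_result (imem s0) (rmem s0) \<omega> \<noteq> None} =
      ennreal ((\<Sum>i<n. \<Sum>j<n. (a j i)\<^sup>2) / (2 * real n * mean)\<^sup>2)"
    using accept[of "\<lambda>_. True"] sum_threshold[OF f] by (simp add: power_mult_distrib mult.commute)
  show "emeasure coins {\<omega>. round_result (imem s0) (rmem s0) \<omega> = Some i} =
      ennreal ((\<Sum>j<n. (a j i)\<^sup>2) / (2 * real n * mean)\<^sup>2)" if "i < n"
  proof -
    have "{\<omega>. round_result (imem s0) (rmem s0) \<omega> = Some i} =
        {\<omega>. imem s0 (slot n (\<omega> 0) (\<omega> 1)) = i \<and> \<omega> 4 < ?T (slot n (\<omega> 0) (\<omega> 1)) (slot n (\<omega> 2) (\<omega> 3))}"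
      by (auto simp: round_result_def)
    then show ?thesis
      using accept[of "\<lambda>s. imem s0 s = i"] sum_threshold_index[OF f that]
      by (simp add: power_mult_distrib mult.commute)
  qed
qed

lemma expected_rounds: "(\<integral>\<^sup>+\<omega>. trial_count \<omega> \<partial>coins) \<le> ennreal (4 * real n)"
proof -
  let ?F = "\<Sum>i<n. \<Sum>j<n. (a j i)\<^sup>2"
  have m: "0 < (real n * mean)\<^sup>2" using n mean_pos by simp
  then have "0 < real n * ?F" using trace_square_le by linarith
  then have F: "0 < ?F" by (simp add: zero_less_mult_iff)
  have "(\<integral>\<^sup>+\<omega>. trial_count \<omega> \<partial>coins) = ennreal (1 / (?F / (2 * real n * mean)\<^sup>2))"
    using F m by (intro expectation_trial_count round_success_probability(1)) (simp add: power_mult_distrib)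
  also have "1 / (?F / (2 * real n * mean)\<^sup>2) = 4 * (real n * mean)\<^sup>2 / ?F"
    by (simp add: power_mult_distrib)
  also have "\<dots> \<le> 4 * real n"
    using trace_square_le F by (simp add: divide_le_eq mult.commute)
  finally show ?thesis using order_refl by (simp add: ennreal_leI)
qed

text \<open>The identities hold for every \<open>\<omega>\<close>, divergence included, where the
  output is \<open>None\<close> and both costs are infinite. Measurability of output and costs can
  thus be read off the right-hand sides.\<close>

lemma sampler_outcome:
  assumes A: "a = entry A" "dim_row A = n"
  shows "output_index sampler A \<omega> = first_success \<omega>"
    "query_count sampler A \<omega> = of_nat (queries s0) + trial_count \<omega>"
    "op_count sampler A \<omega> = of_nat (ops s0 + 2) + 18 * trial_count \<omega>"
proof -
  have "output_index sampler A \<omega> = first_success \<omega> \<and>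
    query_count sampler A \<omega> = of_nat (queries s0) + trial_count \<omega> \<and>
    op_count sampler A \<omega> = of_nat (ops s0 + 2) + 18 * trial_count \<omega>"
  proof (cases "\<exists>m. trial m \<omega> \<noteq> None")
    case True
    define m where "m = (LEAST m. trial m \<omega> \<noteq> None)"
    have "trial m \<omega> \<noteq> None" unfolding m_def using True by (rule LeastI_ex)
    moreover have m: "fails m \<omega>"
      unfolding fails_def m_def by (blast dest: not_less_Least)
    ultimately obtain i where i: "trial m \<omega> = Some i" by blast
    obtain t where t: "exec n a \<omega> sampler (initial n) t" "ireg t 0 = i"
        "ops t = ops s0 + 2 + 18 * Suc m" "queries t = queries s0 + Suc m"
      using exec_sampler[OF m i] by blast
    have "result sampler A \<omega> = Some t"
      using result_eq_SomeI[of A \<omega> sampler t] t(1) A by simp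
    moreover have "trial_count \<omega> = of_nat (Suc m)" using trial_count_first[OF m] i by simp
    moreover have "first_success \<omega> = Some i" using first_success_Some_iff m i by blast
    ultimately show ?thesis
      unfolding output_index_def query_count_def op_count_def by (simp add: t(2-4))
  next
    case False
    then have "\<not> (\<exists>t. exec n a \<omega> sampler (initial n) t)"
      using exec_sampler_trial by blast
    then have "result sampler A \<omega> = None"
      using A by (simp add: result_def Let_def)
    moreover have "first_success \<omega> = None" using False by (auto simp: first_success_def)
    moreover have "trial_count \<omega> = \<infinity>" using False by (intro trial_count_infinite) auto
    ultimately show ?thesis
      unfolding output_index_def query_count_def op_count_def by (simp add: ennreal_mult_top)
  qed
  then show "output_index sampler A \<omega> = first_success \<omega>"
    "query_count sampler A \<omega> = of_nat (queries s0) + trial_count \<omega>"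
    "op_count sampler A \<omega> = of_nat (ops s0 + 2) + 18 * trial_count \<omega>" by blast+
qed

text \<open>For the operations, (13 + 25n) + 2 + 18 * 4n = 15 + 97n, which is at most 112n since n
  is at least 1. The queries stay below 1 + 3n + 4n in expectation or equal it.\<close>

lemma expected_cost:
  "(\<integral>\<^sup>+\<omega>. of_nat (queries s0) + trial_count \<omega> \<partial>coins) \<le> ennreal (112 * real n)"
  "(\<integral>\<^sup>+\<omega>. of_nat (ops s0 + 2) + 18 * trial_count \<omega> \<partial>coins) \<le> ennreal (112 * real n)"
proof -
  have n1: "1 \<le> real n" using n by simp
  have "(\<integral>\<^sup>+\<omega>. of_nat (queries s0) + trial_count \<omega> \<partial>coins) \<le> ennreal (queries s0) + ennreal (4 * real n)"
    using expected_rounds by (subst nn_integral_add) (simp_all add: ennreal_of_nat_eq_real_of_nat add_left_mono)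
  also have "\<dots> = ennreal (queries s0 + 4 * real n)" by simp
  also have "\<dots> \<le> ennreal (112 * real n)"
    using prepared n1 by (intro ennreal_leI) (simp add: prepared_def)
  finally show "(\<integral>\<^sup>+\<omega>. of_nat (queries s0) + trial_count \<omega> \<partial>coins) \<le> ennreal (112 * real n)" .
  have "(\<integral>\<^sup>+\<omega>. of_nat (ops s0 + 2) + 18 * trial_count \<omega> \<partial>coins) =
      of_nat (ops s0 + 2) + 18 * (\<integral>\<^sup>+\<omega>. trial_count \<omega> \<partial>coins)"
    by (subst nn_integral_add) (simp_all add: nn_integral_cmult)
  also have "\<dots> \<le> ennreal (ops s0 + 2) + ennreal 18 * ennreal (4 * real n)"
    using expected_rounds
    by (intro add_mono mult_mono) (simp_all add: ennreal_of_nat_eq_real_of_nat[symmetric])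
  also have "\<dots> = ennreal (ops s0 + 2 + 72 * real n)"
    by (simp add: ennreal_mult[symmetric] del: ennreal_numeral)
  also have "\<dots> \<le> ennreal (112 * real n)"
    using prepared n1 by (intro ennreal_leI) (simp add: prepared_def)
  finally show "(\<integral>\<^sup>+\<omega>. of_nat (ops s0 + 2) + 18 * trial_count \<omega> \<partial>coins) \<le> ennreal (112 * real n)" .
qed

text \<open>Both round probabilities have the same denominator, which cancels in their
  quotient.\<close>

lemma output_probability:
  assumes "i < n"
  shows "measure coins {\<omega>. first_success \<omega> = Some i} =
    (\<Sum>j<n. (a j i)\<^sup>2) / (\<Sum>i<n. \<Sum>j<n. (a j i)\<^sup>2)"
proof -
  let ?F = "\<Sum>i<n. \<Sum>j<n. (a j i)\<^sup>2"
  have m: "0 < (real n * mean)\<^sup>2" using n mean_pos by simp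
  then have "0 < real n * ?F" using trace_square_le by linarith
  then have F: "0 < ?F" by (simp add: zero_less_mult_iff)
  have p: "0 < ?F / (2 * real n * mean)\<^sup>2" using F m by (simp add: power_mult_distrib)
  show ?thesis
    using measure_first_success[OF p round_success_probability(1) round_success_probability(2)[OF assms]] m
    by (simp add: sum_nonneg)
qed

end

end

section \<open>Sampling columns\<close>

lemma vec_l2_norm_col_square:
  "i < dim_col A \<Longrightarrow> (vec_l2_norm (col A i))\<^sup>2 = (\<Sum>j<dim_row A. (A $$ (j, i))\<^sup>2)"
  by (simp add: vec_l2_norm_def L2_set_def sum_nonneg)

lemma frobenius_norm_square:
  "(frobenius_norm A)\<^sup>2 = (\<Sum>i<dim_col A. \<Sum>j<dim_row A. (A $$ (j, i))\<^sup>2)"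
  by (subst sum.swap) (simp add: frobenius_norm_def sum_nonneg)

theorem theorem1:
  shows "\<exists>(C::real) (P::com). C > 0 \<and>
    (\<forall>(n::nat) (A::real mat). n \<ge> 1 \<and> A \<in> carrier_mat n n \<and> A \<noteq> 0\<^sub>m n n \<and> psd A \<longrightarrow>
       output_index P A \<in> measurable coins (count_space UNIV) \<and>
       query_count P A \<in> borel_measurable coins \<and>
       op_count P A \<in> borel_measurable coins \<and>
       (\<forall>i<n. measure coins {\<omega> \<in> space coins. output_index P A \<omega> = Some i}
              = (vec_l2_norm (col A i))\<^sup>2 / (frobenius_norm A)\<^sup>2) \<and>
       (\<integral>\<^sup>+ \<omega>. query_count P A \<omega> \<partial>coins) \<le> ennreal (C * real n) \<and>
       (\<integral>\<^sup>+ \<omega>. op_count P A \<omega> \<partial>coins) \<le> ennreal (C * real n))"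
proof (rule exI[of _ 112], rule exI[of _ sampler], rule conjI, simp, intro allI impI)
  fix n :: nat and A :: "real mat"
  assume "n \<ge> 1 \<and> A \<in> carrier_mat n n \<and> A \<noteq> 0\<^sub>m n n \<and> psd A"
  then have A: "A \<in> carrier_mat n n" "dim_row A = n" "dim_col A = n" and "table n (entry A)"
    using psd_table by auto
  then interpret table n "entry A" by simp
  obtain s where s: "prepared s" "\<And>\<omega>. exec n (entry A) \<omega> preparation (initial n) s"
    using exec_preparation by blast
  interpret trials 5 "round_result (imem s) (rmem s)" by (rule trials_round_result)
  have outcome: "output_index sampler A = first_success"
    "query_count sampler A = (\<lambda>\<omega>. of_nat (queries s) + trial_count \<omega>)"
    "op_count sampler A = (\<lambda>\<omega>. of_nat (ops s + 2) + 18 * trial_count \<omega>)"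
    using sampler_outcome[OF s refl A(2)] by blast+
  have "measure coins {\<omega> \<in> space coins. first_success \<omega> = Some i} =
      (vec_l2_norm (col A i))\<^sup>2 / (frobenius_norm A)\<^sup>2" if "i < n" for i
    using output_probability[OF s that] that A
    by (simp add: vec_l2_norm_col_square frobenius_norm_square entry_def)
  then show "output_index sampler A \<in> coins \<rightarrow>\<^sub>M count_space UNIV \<and>
       query_count sampler A \<in> borel_measurable coins \<and>
       op_count sampler A \<in> borel_measurable coins \<and>
       (\<forall>i<n. measure coins {\<omega> \<in> space coins. output_index sampler A \<omega> = Some i}
              = (vec_l2_norm (col A i))\<^sup>2 / (frobenius_norm A)\<^sup>2) \<and>
       (\<integral>\<^sup>+ \<omega>. query_count sampler A \<omega> \<partial>coins) \<le> ennreal (112 * real n) \<and>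
       (\<integral>\<^sup>+ \<omega>. op_count sampler A \<omega> \<partial>coins) \<le> ennreal (112 * real n)"
    unfolding outcome using expected_cost[OF s] by simp
qed

end
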